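(* Let $p,q>1$ satisfy $\frac1p+\frac1q\ge1$. If $f\in\mathcal E^p$ and $g\in\mathcal E^q$, then both Faber--Schauder integrals $I_{f,g}$ and $I_{g,f}$ exist on $[0,1]$. More precisely, there exist exponents $\bar p,\bar q>1$ with $\frac1{\bar p}+\frac1{\bar q}=1$ such that $\bar p\ge p$, $\bar q\ge q$, $f\in\mathcal E^{\bar p}$, $g\in\mathcal E^{\bar q}$. With respect to such a pair $(\bar p,\bar q)$, the following hold for the pair $(f,g)$: (a) (Bilinearity and additivity) For all $\alpha,\beta\in\mathbb R$: if $f_2\in C([0,1])$ is such that $I_{f_2,g}$ exists on $[0,1]$, then $I_{\alpha f+\beta f_2,g}$ exists on $[0,1]$ and equals $\alpha I_{f,g}+\beta I_{f_2,g}$; if $g_2\in C([0,1])$ is such that $I_{f,g_2}$ exists on $[0,1]$, then $I_{f,\alpha g+\beta g_2}$ exists on $[0,1]$ and equals $\alpha I_{f,g}+\beta I_{f,g_2}$; and $\int_r^t f\,dg=\int_r^s f\,dg+\int_s^t f\,dg$ for all $r,s,t\in[0,1]$. (b) (Integration by parts) $\int_s^t f\,dg+\int_s^t g\,df=f(t)g(t)-f(s)g(s)$ for all $s,t\in[0,1]$. (c) (Dyadic Young--Lo\`eve estimate) For every $0\le s\le\xi\le t\le1$ and every integer $N\ge0$ with $t-s\le2^{-N}$, $$\bigg|\int_s^t f\,dg-f(\xi)\big(g(t)-g(s)\big)\bigg|\le 8L_f^{(\bar p)}(N)L_g^{(\bar q)}(N).$$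
   Context: $C([0,1])$ denotes the real-valued continuous functions on $[0,1]$, $\|\cdot\|_\infty$ the uniform norm. $\mathbb N_0=\{0,1,2,\dots\}$, $\mathbb N_{-1}=\{-1,0,1,\dots\}$. For $n\in\mathbb N_0$: $t_{n,k}=k2^{-n}$ for $0\le k\le 2^n$, $\mathbb T_n=\{t_{n,k}:0\le k\le 2^n\}$, $\mathbb T=\bigcup_{n\ge0}\mathbb T_n$, $I_n=\{0,\dots,2^n-1\}$; for $t\in\mathbb T$, $\ell(t)=\min\{m\ge0:t\in\mathbb T_m\}$. Dyadic left sums: for $f,g\in C([0,1])$, $t\in\mathbb T$, $n\ge\ell(t)$, $$S_n^L(t;f,g)=\sum_{k=0}^{2^nt-1}f(t_{n,k})\big(g(t_{n,k+1})-g(t_{n,k})\big)$$ (empty sum $=0$). The dyadic integral over $[0,t]$ exists if $(S_n^L(t;f,g))_{n\ge\ell(t)}$ converges, and its limit is denoted $I^{\mathbb T}_{f,g}(t)$. Faber--Schauder integral: if $I^{\mathbb T}_{f,g}(t)$ exists for every $t\in\mathbb T$ and the map $I^{\mathbb T}_{f,g}:\mathbb T\to\mathbb R$ admits a (necessarily unique) continuous extension to $[0,1]$, this extension is denoted $I_{f,g}:[0,1]\to\mathbb R$ and one says that the Faber--Schauder integral $I_{f,g}$ exists on $[0,1]$. In that case $\int_s^t f\,dg:=I_{f,g}(t)-I_{f,g}(s)$ for all $s,t\in[0,1]$. Faber--Schauder coefficients of $f\in C([0,1])$: $\theta^f_{-1,0}=f(1)-f(0)$, and for $n\ge0$, $k\in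 I_n$, $\theta^f_{n,k}=2^{n/2}\big(2f(t_{n+1,2k+1})-f(t_{n,k})-f(t_{n,k+1})\big)$. Level energies ($p>1$): $\zeta_f^{(p)}(-1)=2^{1-\frac1p}|\theta^f_{-1,0}|$ and $\zeta_f^{(p)}(n)=\big(2^{-np/2}\sum_{k\in I_n}|\theta^f_{n,k}|^p\big)^{1/p}$ for $n\ge0$. Schauder tail sequence: $H_f(n)=\sum_{m=n}^\infty 2^{-m/2}\sup_{k\in I_m}|\theta^f_{m,k}|\in[0,\infty]$ for $n\ge0$. Energy space ($p>1$): $\|f\|_{\mathcal E^p}=\|f\|_\infty+\|\zeta_f^{(p)}\|_{\ell^p(\mathbb N_{-1})}+\|H_f\|_{\ell^p(\mathbb N_0)}$ and $\mathcal E^p=\{f\in C([0,1]):\|f\|_{\mathcal E^p}<\infty\}$. For $r>1$ and $h\in C([0,1])$: $\mathcal A_h^{(r)}(n)=\sum_{m=-1}^n 2^{-(n-m)(1-\frac1r)}\zeta_h^{(r)}(m)$ for $n\ge0$, and $$L_h^{(r)}(N)=\|\mathcal A_h^{(r)}\|_{\ell^r_{\ge N}}+\tfrac12\|H_h\|_{\ell^r_{\ge N}},\qquad \|a\|_{\ell^r_{\ge N}}:=\Big(\sum_{n=N}^\infty|a_n|^r\Big)^{1/r},\qquad N\ge0.$$ *)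

theory Defs
  imports "HOL-Analysis.Analysis"
begin

text \<open>
  A function in \<open>C([0,1])\<close> is rendered as a function on the reals that is continuous on
  \<open>{0..1}\<close>; its values outside \<open>{0..1}\<close> are never used.
\<close>

section \<open>Dyadic points and the Faber--Schauder integral\<close>

definition dyadic :: "nat \<Rightarrow> nat \<Rightarrow> real" where
  "dyadic n k = real k / 2 ^ n"

definition dyadic_grid :: "nat \<Rightarrow> real set" where
  "dyadic_grid n = {dyadic n k | k. k \<le> 2 ^ n}"

definition dyadics :: "real set" where
  "dyadics = (\<Union>n. dyadic_grid n)"

definition dyadic_level :: "real \<Rightarrow> nat" where
  "dyadic_level t = (LEAST m. t \<in> dyadic_grid m)"

text \<open>
  For \<open>t\<close> in \<open>dyadic_grid n\<close>, that is, for \<open>n \<ge> dyadic_level t\<close>, the number \<open>2 ^ n * t\<close> is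
  a natural number and the rounding below has no effect.
\<close>

definition dyadic_left_sum ::
    "(real \<Rightarrow> real) \<Rightarrow> (real \<Rightarrow> real) \<Rightarrow> real \<Rightarrow> nat \<Rightarrow> real" where
  "dyadic_left_sum f g t n =
     (\<Sum>k<nat \<lfloor>2 ^ n * t\<rfloor>. f (dyadic n k) * (g (dyadic n (Suc k)) - g (dyadic n k)))"

definition dyadic_integral_exists ::
    "(real \<Rightarrow> real) \<Rightarrow> (real \<Rightarrow> real) \<Rightarrow> real \<Rightarrow> bool" where
  "dyadic_integral_exists f g t \<longleftrightarrow>
     convergent (\<lambda>n. dyadic_left_sum f g t (n + dyadic_level t))"

definition dyadic_integral :: "(real \<Rightarrow> real) \<Rightarrow> (real \<Rightarrow> real) \<Rightarrow> real \<Rightarrow> real" where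
  "dyadic_integral f g t = lim (\<lambda>n. dyadic_left_sum f g t (n + dyadic_level t))"

definition continuous_dyadic_extension ::
    "(real \<Rightarrow> real) \<Rightarrow> (real \<Rightarrow> real) \<Rightarrow> (real \<Rightarrow> real) \<Rightarrow> bool" where
  "continuous_dyadic_extension f g F \<longleftrightarrow>
     continuous_on {0..1} F \<and> (\<forall>t\<in>dyadics. F t = dyadic_integral f g t)"

definition fs_integral_exists :: "(real \<Rightarrow> real) \<Rightarrow> (real \<Rightarrow> real) \<Rightarrow> bool" where
  "fs_integral_exists f g \<longleftrightarrow>
     (\<forall>t\<in>dyadics. dyadic_integral_exists f g t) \<and>
     (\<exists>F. continuous_dyadic_extension f g F)"

text \<open>
  The extension is unique on \<open>{0..1}\<close> because the dyadic points are dense there; the choice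
  operator only picks irrelevant values outside \<open>{0..1}\<close>.
\<close>

definition fs_integral :: "(real \<Rightarrow> real) \<Rightarrow> (real \<Rightarrow> real) \<Rightarrow> real \<Rightarrow> real" where
  "fs_integral f g = (SOME F. continuous_dyadic_extension f g F)"

definition fs_int :: "real \<Rightarrow> real \<Rightarrow> (real \<Rightarrow> real) \<Rightarrow> (real \<Rightarrow> real) \<Rightarrow> real" where
  "fs_int s t f g = fs_integral f g t - fs_integral f g s"

section \<open>Faber--Schauder coefficients and the energy spaces\<close>

text \<open>
  Levels of coefficients are integers \<open>n \<ge> -1\<close>, and at level \<open>-1\<close> the only position is
  \<open>k = 0\<close>. Values at \<open>n < -1\<close> are never used.
\<close>

definition fs_coeff :: "(real \<Rightarrow> real) \<Rightarrow> int \<Rightarrow> nat \<Rightarrow> real" where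
  "fs_coeff f n k =
     (if n = -1 then f 1 - f 0
      else 2 powr (of_int n / 2) *
        (2 * f (dyadic (nat n + 1) (2 * k + 1))
           - f (dyadic (nat n) k) - f (dyadic (nat n) (k + 1))))"

definition level_energy :: "real \<Rightarrow> (real \<Rightarrow> real) \<Rightarrow> int \<Rightarrow> real" where
  "level_energy p f n =
     (if n = -1 then 2 powr (1 - 1 / p) * \<bar>fs_coeff f (-1) 0\<bar>
      else (2 powr (- of_int n * p / 2) *
              (\<Sum>k<2 ^ nat n. \<bar>fs_coeff f n k\<bar> powr p)) powr (1 / p))"

definition schauder_tail :: "(real \<Rightarrow> real) \<Rightarrow> nat \<Rightarrow> ennreal" where
  "schauder_tail f n =
     (\<Sum>\<^sub>\<infinity>m\<in>{n..}.
        ennreal (2 powr (- real m / 2) * (SUP k\<in>{..<2 ^ m}. \<bar>fs_coeff f (int m) k\<bar>)))"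

text \<open>Powers with values in the extended half-line, meant for exponents \<open>p > 0\<close>.\<close>

definition epowr :: "ennreal \<Rightarrow> real \<Rightarrow> ennreal" where
  "epowr x p = (if x = \<infinity> then \<infinity> else ennreal (enn2real x powr p))"

definition lp_norm_on :: "real \<Rightarrow> 'i set \<Rightarrow> ('i \<Rightarrow> ennreal) \<Rightarrow> ennreal" where
  "lp_norm_on p A a = epowr (\<Sum>\<^sub>\<infinity>i\<in>A. epowr (a i) p) (1 / p)"

definition energy_norm :: "real \<Rightarrow> (real \<Rightarrow> real) \<Rightarrow> ennreal" where
  "energy_norm p f =
     (SUP x\<in>{0..1}. ennreal \<bar>f x\<bar>)
     + lp_norm_on p {-1..} (\<lambda>n. ennreal (level_energy p f n))
     + lp_norm_on p UNIV (schauder_tail f)"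

definition energy_space :: "real \<Rightarrow> (real \<Rightarrow> real) set" where
  "energy_space p = {f. continuous_on {0..1} f \<and> energy_norm p f < \<infinity>}"

definition averaged_energy :: "real \<Rightarrow> (real \<Rightarrow> real) \<Rightarrow> nat \<Rightarrow> real" where
  "averaged_energy r h n =
     (\<Sum>m\<in>{-1..int n}. 2 powr (- of_int (int n - m) * (1 - 1 / r)) * level_energy r h m)"

text \<open>
  Extended-valued a priori, since the norms may be infinite for a general continuous \<open>h\<close>.
\<close>

definition loeve_bound :: "real \<Rightarrow> (real \<Rightarrow> real) \<Rightarrow> nat \<Rightarrow> ennreal" where
  "loeve_bound r h N =
     lp_norm_on r {N..} (\<lambda>n. ennreal \<bar>averaged_energy r h n\<bar>)
     + lp_norm_on r {N..} (schauder_tail h) / 2"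

end

theory Submission
  imports Defs
begin

text \<open>
  Refining the dyadic mesh from level \<open>m\<close> to \<open>m + 1\<close> adds to the left sum, over each dyadic
  interval, the product of the increment of \<open>f\<close> over the left half and the increment of \<open>g\<close>
  over the right half. By Hoelder's inequality with conjugate exponents the total change at
  level \<open>m\<close> is bounded by the product of the power norms of these half-increments, and these
  norms are controlled by the averaged energies: a half-increment is half of the increment plus
  or minus half of a suitably normalised Faber--Schauder coefficient, so that the norms satisfy,
  as an inequality, the recursion that defines the averaged energies
  (\<open>incr_plus_energy_le_averaged_energy\<close>). Minkowski's inequality shows that the averaged
  energies are summable to the power \<open>r\<close>
  (\<open>fin_norm_averaged_energy_le\<close>), and a second use of Hoelder's inequality, now across levels,
  makes the changes summable.

  Non-dyadic end points are handled by freezing \<open>f\<close> and \<open>g\<close> outside \<open>{s..t}\<close>. Then one interval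
  per level is cut at \<open>s\<close> and one at \<open>t\<close>, and the increment over a cut interval exceeds the
  full one by at most half of the Schauder tail (\<open>endpoint_deviation_le\<close>), because the tail
  bounds the distance from a function to its dyadic interpolants. The resulting bound
  \<open>abs_clipped_step_le\<close> is uniform in \<open>s\<close> and \<open>t\<close> and does everything else: the frozen left sums
  are continuous in \<open>t\<close> and converge uniformly, so the integral exists
  (\<open>fs_integral_exists_conjugate\<close>); the refinements beyond level \<open>N\<close> contribute at most
  \<open>L\<^sub>f(N) L\<^sub>g(N)\<close>, while the sum at level \<open>N\<close> has at most two terms and is compared with
  \<open>f \<xi> * (g t - g s)\<close> directly, with constant \<open>4\<close>. The estimate therefore holds with \<open>5\<close> in place
  of \<open>8\<close> (\<open>Young_Loeve_estimate\<close>).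

  Integration by parts holds because the sum of the products of increments, which is the defect
  of the discrete formula, is bounded by a null sequence of the same kind
  (\<open>abs_sum_incr_mult_le\<close>). Bilinearity passes to the limit from the left sums. If
  \<open>1 / p + 1 / q > 1\<close>, one exponent is enlarged until the two are conjugate, which is possible
  since the energy spaces increase with the exponent (\<open>energy_space_mono\<close>).
\<close>

section \<open>Finite power norms\<close>

definition fin_norm :: "real \<Rightarrow> 'i set \<Rightarrow> ('i \<Rightarrow> real) \<Rightarrow> real" where
  "fin_norm r F a = (\<Sum>i\<in>F. \<bar>a i\<bar> powr r) powr (1 / r)"

lemma fin_norm_nonneg: "0 \<le> fin_norm r F a"
  by (simp add: fin_norm_def)

lemma fin_norm_powr:
  assumes "r > 0"
  shows "fin_norm r F a powr r = (\<Sum>i\<in>F. \<bar>a i\<bar> powr r)"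
proof -
  have "0 \<le> (\<Sum>i\<in>F. \<bar>a i\<bar> powr r)"
    by (simp add: sum_nonneg)
  then show ?thesis
    using assms by (simp add: fin_norm_def powr_powr)
qed

lemma fin_norm_le_iff:
  assumes "r > 0" "0 \<le> C"
  shows "fin_norm r F a \<le> C \<longleftrightarrow> (\<Sum>i\<in>F. \<bar>a i\<bar> powr r) \<le> C powr r"
  using assms fin_norm_powr[OF assms(1), of F a] fin_norm_nonneg[of r F a]
  by (metis linorder_not_le order.strict_implies_order powr_less_mono2 powr_mono2)

lemma fin_norm_mono:
  assumes "r > 0" "\<And>i. i \<in> F \<Longrightarrow> \<bar>a i\<bar> \<le> \<bar>b i\<bar>"
  shows "fin_norm r F a \<le> fin_norm r F b"
  unfolding fin_norm_def
  using assms by (intro powr_mono2 sum_mono sum_nonneg) auto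

lemma fin_norm_mono_set:
  assumes "r > 0" "finite G" "F \<subseteq> G"
  shows "fin_norm r F a \<le> fin_norm r G a"
  unfolding fin_norm_def
  using assms by (intro powr_mono2 sum_mono2 sum_nonneg) auto

lemma fin_norm_scale:
  assumes "r > 0"
  shows "fin_norm r F (\<lambda>i. c * a i) = \<bar>c\<bar> * fin_norm r F a"
proof -
  have "(\<Sum>i\<in>F. \<bar>c * a i\<bar> powr r) = \<bar>c\<bar> powr r * (\<Sum>i\<in>F. \<bar>a i\<bar> powr r)"
    by (simp add: abs_mult powr_mult sum_distrib_left)
  then show ?thesis
    using assms by (simp add: fin_norm_def powr_mult powr_powr sum_nonneg)
qed

lemma abs_le_fin_norm:
  assumes "r > 0" "finite F" "i \<in> F"
  shows "\<bar>a i\<bar> \<le> fin_norm r F a"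
proof -
  have "\<bar>a i\<bar> powr r \<le> (\<Sum>i\<in>F. \<bar>a i\<bar> powr r)"
    using assms by (intro member_le_sum) auto
  then have "\<bar>a i\<bar> powr r \<le> fin_norm r F a powr r"
    using assms by (simp add: fin_norm_powr)
  then show ?thesis
    using assms(1) fin_norm_nonneg[of r F a]
    by (meson linorder_not_le powr_less_mono2)
qed

lemma fin_norm_reindex:
  "inj_on h F \<Longrightarrow> fin_norm r (h ` F) a = fin_norm r F (\<lambda>i. a (h i))"
  by (simp add: fin_norm_def sum.reindex)

lemma fin_norm_eq_0D:
  assumes "r > 0" "finite F" "fin_norm r F a = 0" "i \<in> F"
  shows "a i = 0"
  using abs_le_fin_norm[OF assms(1,2,4), of a] assms(3) by simp

text \<open>
  After normalising both norms to \<open>1\<close>, Young's inequality applied termwise sums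
  to \<open>1 / p + 1 / q = 1\<close>.
\<close>

theorem Hoelder_sum:
  fixes p q :: real
  assumes "p > 1" "q > 1" "1 / p + 1 / q = 1" "finite F"
  shows "(\<Sum>i\<in>F. \<bar>a i * b i\<bar>) \<le> fin_norm p F a * fin_norm q F b"
proof -
  define X where "X = fin_norm p F a"
  define Y where "Y = fin_norm q F b"
  have XY: "0 \<le> X" "0 \<le> Y"
    by (auto simp: X_def Y_def fin_norm_nonneg)
  show ?thesis
  proof (cases "X = 0 \<or> Y = 0")
    case True
    then have "a i * b i = 0" if "i \<in> F" for i
      using fin_norm_eq_0D[of p F a i] fin_norm_eq_0D[of q F b i] assms that
      by (auto simp: X_def Y_def)
    then have "(\<Sum>i\<in>F. \<bar>a i * b i\<bar>) = 0"
      by (intro sum.neutral) auto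
    then show ?thesis
      by (simp add: fin_norm_nonneg)
  next
    case False
    then have pos: "X > 0" "Y > 0"
      using XY by auto
    have "(\<Sum>i\<in>F. \<bar>a i * b i\<bar> / (X * Y))
        \<le> (\<Sum>i\<in>F. \<bar>a i\<bar> powr p / (p * X powr p) + \<bar>b i\<bar> powr q / (q * Y powr q))"
    proof (intro sum_mono)
      fix i assume "i \<in> F"
      have "(\<bar>a i\<bar> / X) * (\<bar>b i\<bar> / Y) \<le> (\<bar>a i\<bar> / X) powr p / p + (\<bar>b i\<bar> / Y) powr q / q"
        using assms pos by (intro Youngs_inequality) auto
      then show "\<bar>a i * b i\<bar> / (X * Y)
          \<le> \<bar>a i\<bar> powr p / (p * X powr p) + \<bar>b i\<bar> powr q / (q * Y powr q)"
        using pos by (simp add: powr_divide abs_mult mult.commute)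
    qed
    also have "\<dots> = X powr p / (p * X powr p) + Y powr q / (q * Y powr q)"
      using assms by (simp add: sum.distrib X_def Y_def fin_norm_powr flip: sum_divide_distrib)
    also have "\<dots> = 1"
      using assms pos by simp
    finally show ?thesis
      using pos by (simp add: X_def Y_def field_simps flip: sum_divide_distrib)
  qed
qed

text \<open>
  Split one factor off \<open>\<bar>a + b\<bar> powr r\<close> by the triangle inequality
  and apply Hoelder's inequality to the remaining power \<open>r - 1\<close>, whose
  conjugate norm is a power of the left-hand side itself.
\<close>

theorem Minkowski_sum:
  assumes "r > 1" "finite F"
  shows "fin_norm r F (\<lambda>i. a i + b i) \<le> fin_norm r F a + fin_norm r F b"
proof -
  define q where "q = r / (r - 1)"
  have q: "q > 1" "1 / r + 1 / q = 1" "(r - 1) * q = r"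
    using assms by (auto simp: q_def field_simps)
  define T where "T = fin_norm r F (\<lambda>i. a i + b i)"
  have T0: "0 \<le> T"
    by (simp add: T_def fin_norm_nonneg)
  define w where "w i = \<bar>a i + b i\<bar> powr (r - 1)" for i
  have wq: "fin_norm q F w = T powr (r - 1)"
  proof -
    have "(\<Sum>i\<in>F. \<bar>w i\<bar> powr q) = T powr r"
      using assms q by (simp add: w_def powr_powr T_def fin_norm_powr)
    moreover have "r * (1 / q) = r - 1"
      using q assms by (simp add: field_simps)
    ultimately show ?thesis
      using T0 by (simp add: fin_norm_def powr_powr)
  qed
  have "T powr r = (\<Sum>i\<in>F. \<bar>a i + b i\<bar> * w i)"
    using assms by (simp add: T_def fin_norm_powr w_def powr_mult_base)
  also have "\<dots> \<le> (\<Sum>i\<in>F. \<bar>a i * w i\<bar> + \<bar>b i * w i\<bar>)"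
    by (intro sum_mono)
      (simp add: w_def abs_mult abs_triangle_ineq mult_right_mono flip: distrib_right)
  also have "\<dots> \<le> fin_norm r F a * T powr (r - 1) + fin_norm r F b * T powr (r - 1)"
    unfolding sum.distrib
    using Hoelder_sum[OF assms(1) q(1,2) assms(2), of a w]
      Hoelder_sum[OF assms(1) q(1,2) assms(2), of b w] by (simp add: wq)
  finally have *: "T powr r \<le> (fin_norm r F a + fin_norm r F b) * T powr (r - 1)"
    by (simp add: algebra_simps)
  show ?thesis
  proof (cases "T = 0")
    case True
    then show ?thesis
      using fin_norm_nonneg[of r F a] fin_norm_nonneg[of r F b] by (simp add: T_def)
  next
    case False
    then have "T * T powr (r - 1) = T powr r"
      using T0 by (simp add: powr_mult_base)
    then show ?thesis
      using * False T0 mult_le_cancel_right_pos[of "T powr (r - 1)" T]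
      by (simp add: T_def)
  qed
qed

text \<open>
  Every entry is at most the \<open>q\<close>-norm, so the surplus power
  \<open>q' - q\<close> of each entry can be replaced by that of the norm.
\<close>

lemma fin_norm_antimono_exponent:
  assumes "0 < q" "q \<le> q'" "finite F"
  shows "fin_norm q' F a \<le> fin_norm q F a"
proof -
  define X where "X = fin_norm q F a"
  have X0: "0 \<le> X"
    by (simp add: X_def fin_norm_nonneg)
  have "(\<Sum>i\<in>F. \<bar>a i\<bar> powr q') \<le> (\<Sum>i\<in>F. \<bar>a i\<bar> powr q * X powr (q' - q))"
  proof (intro sum_mono)
    fix i assume "i \<in> F"
    then have "\<bar>a i\<bar> powr (q' - q) \<le> X powr (q' - q)"
      using assms abs_le_fin_norm[of q F i a] by (intro powr_mono2) (auto simp: X_def)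
    then have "\<bar>a i\<bar> powr q * \<bar>a i\<bar> powr (q' - q) \<le> \<bar>a i\<bar> powr q * X powr (q' - q)"
      by (simp add: mult_left_mono)
    then show "\<bar>a i\<bar> powr q' \<le> \<bar>a i\<bar> powr q * X powr (q' - q)"
      by (simp flip: powr_add)
  qed
  also have "\<dots> = X powr q'"
    using assms fin_norm_powr[of q F a] powr_add[of X q "q' - q"]
    by (simp add: X_def flip: sum_distrib_right)
  finally show ?thesis
    using assms X0 by (simp add: fin_norm_le_iff X_def)
qed

section \<open>Norms with values in the extended half-line\<close>

lemma epowr_ennreal [simp]: "0 \<le> x \<Longrightarrow> epowr (ennreal x) p = ennreal (x powr p)"
  by (simp add: epowr_def)

lemma epowr_mono:
  assumes "x \<le> y" "0 < p"
  shows "epowr x p \<le> epowr y p"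
proof (cases y)
  case (real v)
  then obtain u where "x = ennreal u" "0 \<le> u" "u \<le> v"
    using assms by (cases x) (auto simp: top_unique)
  then show ?thesis
    using real assms by (auto intro!: ennreal_leI powr_mono2)
qed (simp add: epowr_def)

lemma ennreal_summable: "(a :: 'i \<Rightarrow> ennreal) summable_on A"
  by (rule nonneg_summable_on_complete) simp

lemma sum_le_infsum_ennreal:
  fixes a :: "'i \<Rightarrow> ennreal"
  assumes "finite F" "F \<subseteq> A"
  shows "sum a F \<le> infsum a A"
proof -
  have "infsum a F \<le> infsum a A"
    using assms by (intro infsum_mono_neutral ennreal_summable) auto
  then show ?thesis
    using assms by simp
qed

text \<open>
  Together with \<open>lp_norm_on_le\<close> this translates between extended-valued norms
  over infinite index sets and uniform bounds on \<open>fin_norm\<close> over finite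
  subsets, where Hoelder's and Minkowski's inequalities are available for real numbers.
\<close>

lemma lp_norm_onD:
  fixes a :: "'i \<Rightarrow> ennreal"
  assumes "r > 0" "lp_norm_on r A a < \<infinity>"
  shows "i \<in> A \<Longrightarrow> a i < \<infinity>"
    and "\<lbrakk>finite F; F \<subseteq> A\<rbrakk>
      \<Longrightarrow> fin_norm r F (\<lambda>i. enn2real (a i)) \<le> enn2real (lp_norm_on r A a)"
proof -
  define Z where "Z = (\<Sum>\<^sub>\<infinity>i\<in>A. epowr (a i) r)"
  have Zfin: "Z \<noteq> \<infinity>"
    using assms(2) by (auto simp: lp_norm_on_def Z_def epowr_def split: if_splits)
  then obtain z where z: "Z = ennreal z" "0 \<le> z"
    by (cases Z) auto
  have le: "(\<Sum>i\<in>F. epowr (a i) r) \<le> Z" if "finite F" "F \<subseteq> A" for F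
    unfolding Z_def using that by (rule sum_le_infsum_ennreal)
  show fin: "a i < \<infinity>" if "i \<in> A" for i
  proof (rule ccontr)
    assume "\<not> a i < \<infinity>"
    then have "epowr (a i) r = \<infinity>"
      by (simp add: epowr_def top.not_eq_extremum)
    then show False
      using le[of "{i}"] that Zfin by (simp add: top_unique)
  qed
  assume F: "finite F" "F \<subseteq> A"
  have "ennreal (\<Sum>i\<in>F. \<bar>enn2real (a i)\<bar> powr r) = (\<Sum>i\<in>F. epowr (a i) r)"
  proof -
    have "epowr (a i) r = ennreal (\<bar>enn2real (a i)\<bar> powr r)" if "i \<in> F" for i
      using fin[of i] that F by (auto simp: epowr_def)
    then show ?thesis
      by (simp add: sum_ennreal)
  qed
  then have "(\<Sum>i\<in>F. \<bar>enn2real (a i)\<bar> powr r) \<le> z"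
    using le[OF F] z by (metis ennreal_le_iff)
  then have "fin_norm r F (\<lambda>i. enn2real (a i)) \<le> z powr (1 / r)"
    unfolding fin_norm_def using assms by (intro powr_mono2) (auto intro!: sum_nonneg)
  moreover have "lp_norm_on r A a = ennreal (z powr (1 / r))"
    using z by (simp add: lp_norm_on_def flip: Z_def)
  ultimately show "fin_norm r F (\<lambda>i. enn2real (a i)) \<le> enn2real (lp_norm_on r A a)"
    by simp
qed

lemma lp_norm_on_le:
  fixes b :: "'i \<Rightarrow> real"
  assumes "r > 0" "0 \<le> C" "\<And>i. i \<in> A \<Longrightarrow> 0 \<le> b i"
    and "\<And>F. \<lbrakk>finite F; F \<subseteq> A\<rbrakk> \<Longrightarrow> fin_norm r F b \<le> C"
  shows "lp_norm_on r A (\<lambda>i. ennreal (b i)) \<le> ennreal C"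
proof -
  have "(\<Sum>\<^sub>\<infinity>i\<in>A. epowr (ennreal (b i)) r) \<le> ennreal (C powr r)"
  proof (rule infsum_le_finite_sums)
    fix F assume F: "finite F" "F \<subseteq> A"
    have "(\<Sum>i\<in>F. epowr (ennreal (b i)) r) = ennreal (\<Sum>i\<in>F. \<bar>b i\<bar> powr r)"
    proof -
      have "epowr (ennreal (b i)) r = ennreal (\<bar>b i\<bar> powr r)" if "i \<in> F" for i
        using assms(3)[of i] that F by auto
      then show ?thesis
        by (simp add: sum_ennreal)
    qed
    also have "\<dots> \<le> ennreal (C powr r)"
      using assms(4)[OF F] assms(1,2) by (simp add: fin_norm_le_iff ennreal_leI)
    finally show "(\<Sum>i\<in>F. epowr (ennreal (b i)) r) \<le> ennreal (C powr r)" .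
  qed (rule ennreal_summable)
  then have "lp_norm_on r A (\<lambda>i. ennreal (b i)) \<le> epowr (ennreal (C powr r)) (1 / r)"
    unfolding lp_norm_on_def using assms by (intro epowr_mono) auto
  also have "\<dots> = ennreal C"
    using assms by (simp add: powr_powr)
  finally show ?thesis .
qed

lemma lp_norm_on_mono_set:
  assumes "r > 0" "A \<subseteq> B"
  shows "lp_norm_on r A a \<le> lp_norm_on r B a"
  unfolding lp_norm_on_def
  using assms by (intro epowr_mono infsum_mono_neutral ennreal_summable) auto

lemma lp_norm_on_antimono_exponent:
  fixes a :: "'i \<Rightarrow> ennreal"
  assumes "0 < q" "q \<le> q'" "lp_norm_on q A a < \<infinity>"
  shows "lp_norm_on q' A a < \<infinity>"
proof -
  have fin: "a i < \<infinity>" if "i \<in> A" for i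
    using lp_norm_onD(1)[of q A a i] assms that by auto
  define X where "X = enn2real (lp_norm_on q A a)"
  have "lp_norm_on q' A (\<lambda>i. ennreal (enn2real (a i))) \<le> ennreal X"
  proof (rule lp_norm_on_le)
    fix F assume F: "finite F" "F \<subseteq> A"
    show "fin_norm q' F (\<lambda>i. enn2real (a i)) \<le> X"
      using fin_norm_antimono_exponent[of q q' F] lp_norm_onD(2)[of q A a F] assms F
      unfolding X_def by (meson order_trans)
  qed (use assms in \<open>auto simp: X_def\<close>)
  moreover have "lp_norm_on q' A (\<lambda>i. ennreal (enn2real (a i))) = lp_norm_on q' A a"
  proof -
    have "(\<Sum>\<^sub>\<infinity>i\<in>A. epowr (ennreal (enn2real (a i))) q') = (\<Sum>\<^sub>\<infinity>i\<in>A. epowr (a i) q')"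
      using fin by (intro infsum_cong) (simp add: less_top)
    then show ?thesis
      by (simp add: lp_norm_on_def)
  qed
  ultimately show ?thesis
    using ennreal_less_top order_le_less_trans by fastforce
qed

section \<open>Increments over dyadic intervals\<close>

definition incr :: "(real \<Rightarrow> real) \<Rightarrow> nat \<Rightarrow> nat \<Rightarrow> real" where
  "incr f n k = f (dyadic n (Suc k)) - f (dyadic n k)"

text \<open>
  The factor \<open>2 powr (n / 2)\<close> of a Faber--Schauder coefficient and the
  normalisation of a level energy cancel; this bare second difference is what is left.
\<close>

definition kink :: "(real \<Rightarrow> real) \<Rightarrow> nat \<Rightarrow> nat \<Rightarrow> real" where
  "kink f n k = 2 * f (dyadic (Suc n) (2 * k + 1)) - f (dyadic n k) - f (dyadic n (Suc k))"

lemma dyadic_double [simp]: "dyadic (Suc n) (2 * k) = dyadic n k"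
  by (simp add: dyadic_def)

lemma dyadic_double_Suc_Suc [simp]: "dyadic (Suc n) (Suc (Suc (2 * k))) = dyadic n (Suc k)"
  by (simp add: dyadic_def field_simps)

lemma dyadic_mono: "j \<le> k \<Longrightarrow> dyadic n j \<le> dyadic n k"
  by (simp add: dyadic_def divide_right_mono)

lemma dyadic_nonneg: "0 \<le> dyadic n k"
  by (simp add: dyadic_def)

lemma dyadic_le_1: "k \<le> 2 ^ n \<Longrightarrow> dyadic n k \<le> 1"
  by (simp add: dyadic_def divide_le_eq_1 of_nat_le_iff[of _ "2 ^ n", simplified])

lemma dyadic_Suc: "dyadic n (Suc k) = dyadic n k + 1 / 2 ^ n"
  by (simp add: dyadic_def field_simps)

lemma dyadic_midpoint: "dyadic (Suc n) (Suc (2 * k)) = dyadic n k + 1 / 2 ^ Suc n"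
  by (simp add: dyadic_def field_simps)

lemma incr_even: "incr f (Suc n) (2 * k) = (incr f n k + kink f n k) / 2"
  by (simp add: incr_def kink_def)

lemma incr_odd: "incr f (Suc n) (Suc (2 * k)) = (incr f n k - kink f n k) / 2"
  by (simp add: incr_def kink_def)

lemma abs_fs_coeff: "\<bar>fs_coeff f (int n) k\<bar> = 2 powr (real n / 2) * \<bar>kink f n k\<bar>"
  by (simp add: fs_coeff_def kink_def abs_mult)

lemma sum_split_parity:
  fixes a :: "nat \<Rightarrow> 'a :: comm_monoid_add"
  shows "(\<Sum>k<2 * N. a k) = (\<Sum>k<N. a (2 * k) + a (Suc (2 * k)))"
  by (induction N) (auto simp: algebra_simps)

text \<open>
  In terms of the bare second differences a level energy is a plain power norm, which brings
  Minkowski's and Hoelder's inequalities to bear on it.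
\<close>

lemma level_energy_eq:
  assumes "r > 0"
  shows "level_energy r f (int n) = fin_norm r {..<2 ^ n} (kink f n)"
proof -
  have "2 powr (- real n * r / 2) * (2 powr (real n / 2) * \<bar>kink f n k\<bar>) powr r
      = \<bar>kink f n k\<bar> powr r" for k
  proof -
    have "(2 powr (real n / 2)) powr r = 2 powr (real n * r / 2)"
      by (simp add: powr_powr)
    then have "2 powr (- real n * r / 2) * (2 powr (real n / 2) * \<bar>kink f n k\<bar>) powr r
        = (2 powr (- real n * r / 2) * 2 powr (real n * r / 2)) * \<bar>kink f n k\<bar> powr r"
      by (simp add: powr_mult)
    also have "\<dots> = \<bar>kink f n k\<bar> powr r"
      by (simp flip: powr_add)
    finally show ?thesis .
  qed
  then show ?thesis
    by (simp add: level_energy_def fin_norm_def abs_fs_coeff sum_distrib_left)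
qed

lemma level_energy_nonneg: "0 \<le> level_energy r f m"
  by (simp add: level_energy_def)

section \<open>Level energies control dyadic increments\<close>

text \<open>
  The factor by which the power norm of the increments of an affine function shrinks when
  the dyadic mesh is halved; it is also the ratio of the geometric weights in
  \<open>averaged_energy\<close>.
\<close>

abbreviation decay :: "real \<Rightarrow> real" where
  "decay r \<equiv> 2 powr (- (1 - 1 / r))"

lemma decay_eq: "decay r = 2 powr (1 / r) / 2"
proof -
  have "decay r = 2 powr (1 / r + - 1)"
    by simp
  also have "\<dots> = 2 powr (1 / r) * 2 powr (- 1)"
    by (rule powr_add)
  also have "(2::real) powr (- 1) = 1 / 2"
    by (simp add: powr_minus_divide)
  finally show ?thesis
    by simp
qed

lemma averaged_energy_0:
  "averaged_energy r h 0 = decay r * level_energy r h (- 1) + level_energy r h 0"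
proof -
  have "{- 1..0 :: int} = {- 1, 0}"
    by auto
  then show ?thesis
    by (simp add: averaged_energy_def)
qed

lemma averaged_energy_Suc:
  "averaged_energy r h (Suc n) = decay r * averaged_energy r h n + level_energy r h (int (Suc n))"
proof -
  have set: "{- 1..int (Suc n)} = insert (int (Suc n)) {- 1..int n}"
    by auto
  have "2 powr (- of_int (int (Suc n) - m) * (1 - 1 / r))
      = decay r * 2 powr (- of_int (int n - m) * (1 - 1 / r))" for m
    by (simp add: algebra_simps flip: powr_add)
  then have "(\<Sum>m\<in>{- 1..int n}.
        2 powr (- of_int (int (Suc n) - m) * (1 - 1 / r)) * level_energy r h m)
      = decay r * averaged_energy r h n"
    by (simp only: averaged_energy_def sum_distrib_left mult.assoc)
  then show ?thesis
    unfolding averaged_energy_def[of r h "Suc n"] set by (subst sum.insert) auto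
qed

lemma averaged_energy_nonneg: "0 \<le> averaged_energy r h n"
  by (simp add: averaged_energy_def sum_nonneg level_energy_nonneg)

text \<open>
  Each of the two halves of a dyadic interval carries half of the increment, corrected up or
  down by half of the second difference. Minkowski's inequality bounds the family of left
  halves and that of right halves; putting the two families together costs the factor
  \<open>2 powr (1 / r)\<close>.
\<close>

lemma fin_norm_incr_Suc_le:
  assumes "r > 1"
  shows "fin_norm r {..<2 ^ Suc n} (incr f (Suc n))
    \<le> decay r * (fin_norm r {..<2 ^ n} (incr f n) + level_energy r f (int n))"
    (is ?incr)
    and "fin_norm r {..<2 ^ n} (\<lambda>k. incr f (Suc n) (2 * k))
    \<le> (fin_norm r {..<2 ^ n} (incr f n) + level_energy r f (int n)) / 2" (is ?even)
    and "fin_norm r {..<2 ^ n} (\<lambda>k. incr f (Suc n) (Suc (2 * k)))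
    \<le> (fin_norm r {..<2 ^ n} (incr f n) + level_energy r f (int n)) / 2" (is ?odd)
proof -
  let ?W = "fin_norm r {..<2 ^ n} (incr f n) + level_energy r f (int n)"
  let ?E = "fin_norm r {..<2 ^ n} (\<lambda>k. incr f (Suc n) (2 * k))"
  let ?O = "fin_norm r {..<2 ^ n} (\<lambda>k. incr f (Suc n) (Suc (2 * k)))"
  have W: "?W = fin_norm r {..<2 ^ n} (incr f n) + fin_norm r {..<2 ^ n} (kink f n)"
    using assms by (simp add: level_energy_eq)
  have W0: "0 \<le> ?W"
    by (simp add: fin_norm_nonneg level_energy_nonneg)
  have "?E = \<bar>1 / 2\<bar> * fin_norm r {..<2 ^ n} (\<lambda>k. incr f n k + kink f n k)"
    using assms by (subst fin_norm_scale[symmetric]) (auto simp: incr_even)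
  also have "\<dots> \<le> ?W / 2"
    using Minkowski_sum[OF assms, of "{..<2 ^ n}" "incr f n" "kink f n"] W by simp
  finally show E: "?E \<le> ?W / 2" .
  have "?O = \<bar>1 / 2\<bar> * fin_norm r {..<2 ^ n} (\<lambda>k. incr f n k + - 1 * kink f n k)"
    using assms by (subst fin_norm_scale[symmetric]) (auto simp: incr_odd)
  also have "\<dots> \<le> (fin_norm r {..<2 ^ n} (incr f n)
      + fin_norm r {..<2 ^ n} (\<lambda>k. - 1 * kink f n k)) / 2"
    using Minkowski_sum[OF assms, of "{..<2 ^ n}" "incr f n" "\<lambda>k. - 1 * kink f n k"] by simp
  also have "\<dots> = ?W / 2"
    using assms W by (subst fin_norm_scale) auto
  finally show O: "?O \<le> ?W / 2" .
  have "fin_norm r {..<2 ^ Suc n} (incr f (Suc n)) powr r = ?E powr r + ?O powr r"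
    using assms by (simp add: fin_norm_powr sum_split_parity sum.distrib)
  also have "\<dots> \<le> (?W / 2) powr r + (?W / 2) powr r"
    using E O assms by (intro add_mono powr_mono2) (auto simp: fin_norm_nonneg)
  also have "\<dots> = (2 powr (1 / r) * (?W / 2)) powr r"
  proof -
    have "(2 powr (1 / r)) powr r = 2"
      using assms by (simp add: powr_powr)
    then show ?thesis
      using powr_mult[of "2 powr (1 / r)" "?W / 2" r] by simp
  qed
  finally have "fin_norm r {..<2 ^ Suc n} (incr f (Suc n)) \<le> 2 powr (1 / r) * (?W / 2)"
    using assms W0 by (subst fin_norm_le_iff) (simp_all add: fin_norm_powr)
  then show "fin_norm r {..<2 ^ Suc n} (incr f (Suc n)) \<le> decay r * ?W"
    unfolding decay_eq by simp
qed

text \<open>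
  The averaged energies solve the recursion of which the preceding lemma gives the
  inequality for increments. The weight \<open>2 powr (1 - 1 / r)\<close> in the energy at
  level \<open>-1\<close> is what makes the two recursions start at the same value.
\<close>

lemma incr_plus_energy_le_averaged_energy:
  assumes "r > 1"
  shows "fin_norm r {..<2 ^ n} (incr f n) + level_energy r f (int n) \<le> averaged_energy r f n"
proof (induction n)
  case 0
  have "fin_norm r {..<1} (incr f 0) = \<bar>f 1 - f 0\<bar>"
    using assms by (simp add: fin_norm_def incr_def dyadic_def powr_powr)
  also have "\<dots> = (decay r * 2 powr (1 - 1 / r)) * \<bar>f 1 - f 0\<bar>"
    by (simp flip: powr_add)
  also have "\<dots> = decay r * level_energy r f (- 1)"
    by (simp add: level_energy_def fs_coeff_def)
  finally show ?case
    by (simp add: averaged_energy_0)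
next
  case (Suc n)
  have "fin_norm r {..<2 ^ Suc n} (incr f (Suc n)) \<le> decay r * averaged_energy r f n"
    using fin_norm_incr_Suc_le(1)[OF assms, of n f] Suc
    by (meson mult_left_mono order_trans powr_ge_zero)
  then show ?case
    by (simp add: averaged_energy_Suc del: of_nat_Suc power_Suc)
qed

lemma fin_norm_half_incr_le:
  assumes "r > 1"
  shows "fin_norm r {..<2 ^ n} (\<lambda>k. incr f (Suc n) (2 * k)) \<le> averaged_energy r f n / 2"
    and "fin_norm r {..<2 ^ n} (\<lambda>k. incr f (Suc n) (Suc (2 * k))) \<le> averaged_energy r f n / 2"
  using fin_norm_incr_Suc_le(2,3)[OF assms, of n f]
    incr_plus_energy_le_averaged_energy[OF assms, of n f] by simp_all

lemma fin_norm_incr_le: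
  assumes "r > 1"
  shows "fin_norm r {..<2 ^ n} (incr f n) \<le> averaged_energy r f n"
  using incr_plus_energy_le_averaged_energy[OF assms, of n f]
    level_energy_nonneg[of r f "int n"] by linarith

lemma abs_incr_le:
  assumes "r > 1" "k < 2 ^ n"
  shows "\<bar>incr f n k\<bar> \<le> averaged_energy r f n"
  using abs_le_fin_norm[of r "{..<2 ^ n}" k "incr f n"] fin_norm_incr_le[OF assms(1), of n f] assms
  by force

text \<open>
  This is Young's inequality for the convolution of the level energies with a geometric
  sequence. It follows from Minkowski's inequality for the recursion: the norm
  \<open>X\<close> of an initial segment satisfies
  \<open>X \<le> decay r * (\<dots> + X) + Z\<close>, and \<open>decay r < 1\<close>.
\<close>

lemma fin_norm_averaged_energy_le:
  assumes "r > 1"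
    and Z: "\<And>M. fin_norm r {..M} (\<lambda>n. level_energy r f (int n)) \<le> Z"
  shows "fin_norm r {..M} (averaged_energy r f)
    \<le> (decay r * level_energy r f (- 1) + Z) / (1 - decay r)"
proof -
  let ?A = "averaged_energy r f"
  define z where "z = level_energy r f (- 1)"
  \<comment> \<open>The averaged energies shifted by one level; the energy at level \<open>-1\<close> enters \<open>A_eq\<close> as a separate term.\<close>
  define B where "B n = (case n of 0 \<Rightarrow> 0 | Suc m \<Rightarrow> ?A m)" for n
  define X where "X = fin_norm r {..M} ?A"
  have A_eq: "?A n = (decay r * (if n = 0 then z else 0) + decay r * B n) + level_energy r f (int n)"
    for n
    by (cases n) (auto simp: B_def z_def averaged_energy_0 averaged_energy_Suc)
  have c: "0 < decay r" "decay r < 1"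
  proof -
    have "decay r < 2 powr 0"
      using assms by (intro powr_less_mono) auto
    then show "decay r < 1"
      by simp
  qed simp
  have "fin_norm r {..M} (\<lambda>n. if n = 0 then z else 0) = \<bar>z\<bar>"
  proof -
    have "(\<Sum>i\<le>M. \<bar>if i = 0 then z else 0\<bar> powr r) = (\<Sum>i\<le>M. if i = 0 then \<bar>z\<bar> powr r else 0)"
      by (intro sum.cong) auto
    then show ?thesis
      using assms by (simp add: fin_norm_def powr_powr)
  qed
  then have 1: "fin_norm r {..M} (\<lambda>n. decay r * (if n = 0 then z else 0)) = decay r * z"
    using assms by (subst fin_norm_scale) (auto simp: z_def level_energy_nonneg)
  have "fin_norm r {..M} B \<le> X"
  proof -
    have "(\<Sum>i\<le>M. \<bar>B i\<bar> powr r) = (\<Sum>i<M. \<bar>?A i\<bar> powr r)"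
    proof (cases M)
      case (Suc m)
      then show ?thesis
        by (simp add: sum.atMost_Suc_shift B_def lessThan_Suc_atMost del: sum.atMost_Suc)
    qed (simp add: B_def)
    then have "fin_norm r {..M} B = fin_norm r {..<M} ?A"
      by (simp add: fin_norm_def)
    also have "\<dots> \<le> X"
      unfolding X_def using assms by (intro fin_norm_mono_set) auto
    finally show ?thesis .
  qed
  then have 2: "fin_norm r {..M} (\<lambda>n. decay r * B n) \<le> decay r * X"
    using assms by (subst fin_norm_scale) auto
  have "X \<le> decay r * z + decay r * X + Z"
    using Minkowski_sum[OF assms(1), of "{..M}"
        "\<lambda>n. decay r * (if n = 0 then z else 0) + decay r * B n" "\<lambda>n. level_energy r f (int n)"]
      Minkowski_sum[OF assms(1), of "{..M}"
        "\<lambda>n. decay r * (if n = 0 then z else 0)" "\<lambda>n. decay r * B n"]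
      1 2 Z[of M]
    unfolding X_def A_eq[symmetric] by simp
  then show ?thesis
    using c by (simp add: X_def z_def field_simps)
qed

section \<open>Tails of the Faber--Schauder expansion control oscillations\<close>

text \<open>
  Twice the height of the largest hat at level \<open>m\<close> of the Faber--Schauder
  expansion.
\<close>

definition peak :: "(real \<Rightarrow> real) \<Rightarrow> nat \<Rightarrow> real" where
  "peak f m = 2 powr (- real m / 2) * (SUP k\<in>{..<2 ^ m}. \<bar>fs_coeff f (int m) k\<bar>)"

definition tail :: "(real \<Rightarrow> real) \<Rightarrow> nat \<Rightarrow> real" where
  "tail f n = enn2real (schauder_tail f n)"

lemma abs_kink_le_peak:
  assumes "k < 2 ^ m"
  shows "\<bar>kink f m k\<bar> \<le> peak f m"
proof -
  have "\<bar>fs_coeff f (int m) k\<bar> \<le> (SUP k\<in>{..<2 ^ m}. \<bar>fs_coeff f (int m) k\<bar>)"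
    using assms by (intro cSUP_upper) auto
  then have "2 powr (- real m / 2) * (2 powr (real m / 2) * \<bar>kink f m k\<bar>) \<le> peak f m"
    unfolding peak_def abs_fs_coeff by (intro mult_left_mono) auto
  moreover have "2 powr (- real m / 2) * (2 powr (real m / 2) * \<bar>kink f m k\<bar>) = \<bar>kink f m k\<bar>"
    by (simp add: powr_minus)
  ultimately show ?thesis
    by (simp only:)
qed

lemma peak_nonneg: "0 \<le> peak f m"
  using abs_kink_le_peak[of 0 m f] by simp

lemma schauder_tail_eq: "schauder_tail f n = (\<Sum>\<^sub>\<infinity>m\<in>{n..}. ennreal (peak f m))"
  by (simp add: schauder_tail_def peak_def)

lemma tail_nonneg: "0 \<le> tail f n"
  by (simp add: tail_def)

lemma sum_peak_le_tail:
  assumes "schauder_tail f n < \<infinity>" "finite F" "F \<subseteq> {n..}"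
  shows "(\<Sum>m\<in>F. peak f m) \<le> tail f n"
proof -
  have "ennreal (\<Sum>m\<in>F. peak f m) \<le> schauder_tail f n"
    using sum_le_infsum_ennreal[OF assms(2,3), of "\<lambda>m. ennreal (peak f m)"]
    by (simp add: schauder_tail_eq sum_ennreal peak_nonneg)
  also have "schauder_tail f n = ennreal (tail f n)"
    using assms(1) by (simp add: tail_def less_top)
  finally show ?thesis
    using ennreal_le_iff tail_nonneg by blast
qed

lemma tail_antimono:
  assumes "schauder_tail f n < \<infinity>" "n \<le> m"
  shows "tail f m \<le> tail f n"
proof -
  have "schauder_tail f m \<le> schauder_tail f n"
    unfolding schauder_tail_eq using assms
    by (intro infsum_mono_neutral ennreal_summable) auto
  then show ?thesis
    using assms(1) unfolding tail_def by (intro enn2real_mono) auto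
qed

text \<open>
  The affine function that agrees with \<open>f\<close> at both ends of the
  \<open>k\<close>-th dyadic interval of level \<open>n\<close>, that is, the partial sum of
  the Faber--Schauder expansion up to level \<open>n - 1\<close>.
\<close>

definition interp :: "(real \<Rightarrow> real) \<Rightarrow> nat \<Rightarrow> nat \<Rightarrow> real \<Rightarrow> real" where
  "interp f n k x = f (dyadic n k) + (x - dyadic n k) * 2 ^ n * incr f n k"

text \<open>
  On a half of the interval the two interpolants agree at one end and differ by half of the
  second difference at the midpoint.
\<close>

lemma interp_refine:
  assumes "x \<in> {dyadic n k..dyadic n (Suc k)}"
  obtains k' where "k' \<in> {2 * k, Suc (2 * k)}"
    "x \<in> {dyadic (Suc n) k'..dyadic (Suc n) (Suc k')}"
    "\<bar>interp f (Suc n) k' x - interp f n k x\<bar> \<le> \<bar>kink f n k\<bar> / 2"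
proof (cases "x \<le> dyadic (Suc n) (Suc (2 * k))")
  case True
  define u where "u = (x - dyadic n k) * 2 ^ n"
  have "x \<le> dyadic n k + 1 / 2 ^ Suc n"
    using True by (simp only: dyadic_midpoint)
  then have u: "0 \<le> u" "u \<le> 1 / 2"
    using assms by (auto simp: u_def field_simps)
  have "interp f (Suc n) (2 * k) x - interp f n k x = u * kink f n k"
    unfolding interp_def u_def dyadic_double incr_even
    by (simp add: algebra_simps add_divide_distrib)
  then have "\<bar>interp f (Suc n) (2 * k) x - interp f n k x\<bar> \<le> 1 / 2 * \<bar>kink f n k\<bar>"
    using u by (simp only: abs_mult) (intro mult_right_mono, auto)
  then show ?thesis
    using that[of "2 * k"] assms True by simp
next
  case False
  define u where "u = (dyadic n (Suc k) - x) * 2 ^ n"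
  have "dyadic n k + 1 / 2 ^ Suc n < x"
    using False by (simp only: dyadic_midpoint not_le)
  then have "1 / 2 \<le> (x - dyadic n k) * 2 ^ n" "(x - dyadic n k) * 2 ^ n \<le> 1"
    using assms by (auto simp: dyadic_Suc field_simps)
  moreover have "u = 1 - (x - dyadic n k) * 2 ^ n"
    by (simp add: u_def dyadic_Suc field_simps)
  ultimately have u: "0 \<le> u" "u \<le> 1 / 2"
    by simp_all
  have u': "(x - dyadic n k) * 2 ^ n = 1 - u"
    "(x - dyadic (Suc n) (Suc (2 * k))) * 2 ^ Suc n = 1 - 2 * u"
    unfolding u_def dyadic_midpoint dyadic_Suc[of n k] by (simp_all add: field_simps)
  have "interp f (Suc n) (Suc (2 * k)) x - interp f n k x = u * kink f n k"
    unfolding interp_def u' incr_odd by (simp add: incr_def kink_def field_simps)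
  then have "\<bar>interp f (Suc n) (Suc (2 * k)) x - interp f n k x\<bar> \<le> 1 / 2 * \<bar>kink f n k\<bar>"
    using u by (simp only: abs_mult) (intro mult_right_mono, auto)
  then show ?thesis
    using that[of "Suc (2 * k)"] assms False by simp
qed

text \<open>
  The interpolation error at an arbitrary real point is pushed down \<open>j\<close> levels,
  each of which costs at most half of its peak. The error at the finest level stays a
  parameter because \<open>x\<close> need not be dyadic; continuity makes it small for large
  \<open>j\<close>.
\<close>

lemma interp_error_le_fine_error:
  assumes "x \<in> {dyadic n k..dyadic n (Suc k)}" "k < 2 ^ n"
    and "\<And>k'. \<lbrakk>k' < 2 ^ (n + j); x \<in> {dyadic (n + j) k'..dyadic (n + j) (Suc k')}\<rbrakk>
      \<Longrightarrow> \<bar>f x - interp f (n + j) k' x\<bar> \<le> e"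
  shows "\<bar>f x - interp f n k x\<bar> \<le> (\<Sum>m=n..<n + j. peak f m) / 2 + e"
  using assms
proof (induction j arbitrary: n k)
  case 0
  then show ?case
    by simp
next
  case (Suc j)
  obtain k' where k': "k' \<in> {2 * k, Suc (2 * k)}"
    "x \<in> {dyadic (Suc n) k'..dyadic (Suc n) (Suc k')}"
    "\<bar>interp f (Suc n) k' x - interp f n k x\<bar> \<le> \<bar>kink f n k\<bar> / 2"
    using interp_refine[OF Suc.prems(1)] by blast
  have "\<bar>f x - interp f (Suc n) k' x\<bar> \<le> (\<Sum>m=Suc n..<Suc n + j. peak f m) / 2 + e"
  proof (rule Suc.IH)
    show "k' < 2 ^ Suc n"
      using k'(1) Suc.prems(2) by auto
  qed (use k' Suc.prems(3) in auto)
  moreover have "(\<Sum>m=n..<n + Suc j. peak f m) = peak f n + (\<Sum>m=Suc n..<Suc n + j. peak f m)"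
    by (subst sum.atLeast_Suc_lessThan) auto
  ultimately show ?case
    using k'(3) abs_kink_le_peak[OF Suc.prems(2), of f] by linarith
qed

lemma ex_inverse_power2_less:
  fixes d :: real
  assumes "0 < d"
  shows "\<exists>j0. \<forall>j\<ge>j0. 1 / 2 ^ j < d"
proof -
  obtain j0 where "(1 / 2) ^ j0 < d"
    using real_arch_pow_inv[of d "1 / 2"] assms by auto
  moreover have "(1 / 2 :: real) ^ j \<le> (1 / 2) ^ j0" if "j \<ge> j0" for j
    using that by (intro power_decreasing) auto
  ultimately show ?thesis
    by (metis order_le_less_trans power_one_over)
qed

lemma interp_error_le_tail:
  assumes "continuous_on {0..1} f" "schauder_tail f n < \<infinity>"
    and "x \<in> {dyadic n k..dyadic n (Suc k)}" "k < 2 ^ n"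
  shows "\<bar>f x - interp f n k x\<bar> \<le> tail f n / 2"
proof (rule field_le_epsilon)
  fix e :: real assume "0 < e"
  have "uniformly_continuous_on {0..1} f"
    using assms(1) by (simp add: compact_uniformly_continuous)
  then obtain d where d: "d > 0"
    "\<And>y z. \<lbrakk>y \<in> {0..1}; z \<in> {0..1}; \<bar>z - y\<bar> < d\<rbrakk> \<Longrightarrow> \<bar>f z - f y\<bar> < e / 2"
    unfolding uniformly_continuous_on_def dist_real_def using \<open>0 < e\<close>
    by (metis half_gt_zero)
  obtain j where j: "1 / 2 ^ j < d"
    using ex_inverse_power2_less[OF d(1)] by blast
  have "\<bar>f x - interp f n k x\<bar> \<le> (\<Sum>m=n..<n + j. peak f m) / 2 + e"
  proof (rule interp_error_le_fine_error[OF assms(3,4)])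
    fix k' assume k': "k' < 2 ^ (n + j)" "x \<in> {dyadic (n + j) k'..dyadic (n + j) (Suc k')}"
    let ?l = "dyadic (n + j) k'" and ?r = "dyadic (n + j) (Suc k')"
    have "(1::real) / 2 ^ (n + j) \<le> 1 / 2 ^ j"
      by (simp add: field_simps power_add)
    then have len: "?r - ?l < d"
      using j by (simp add: dyadic_Suc)
    have mem: "?l \<in> {0..1}" "?r \<in> {0..1}" "x \<in> {0..1}"
      using k' dyadic_nonneg[of "n + j" k'] dyadic_le_1[of "Suc k'" "n + j"] by auto
    define u where "u = (x - ?l) * 2 ^ (n + j)"
    have u: "0 \<le> u" "u \<le> 1"
      using k' by (auto simp: u_def dyadic_Suc field_simps)
    have "\<bar>u * incr f (n + j) k'\<bar> \<le> 1 * \<bar>incr f (n + j) k'\<bar>"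
      using u by (simp only: abs_mult) (intro mult_right_mono, auto)
    moreover have "\<bar>incr f (n + j) k'\<bar> < e / 2"
      unfolding incr_def using d(2)[OF mem(1,2)] len k' by auto
    moreover have "\<bar>f x - f ?l\<bar> < e / 2"
      using d(2)[OF mem(1,3)] len k' by auto
    ultimately show "\<bar>f x - interp f (n + j) k' x\<bar> \<le> e"
      unfolding interp_def u_def[symmetric] by linarith
  qed
  also have "(\<Sum>m=n..<n + j. peak f m) \<le> tail f n"
    using assms(2) by (intro sum_peak_le_tail) auto
  finally show "\<bar>f x - interp f n k x\<bar> \<le> tail f n / 2 + e"
    by simp
qed

text \<open>
  This is how the tail sequence enters the estimates: it pays for an interval that is cut
  off at a non-dyadic point.
\<close>

lemma endpoint_deviation_le:
  assumes "continuous_on {0..1} f" "schauder_tail f n < \<infinity>"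
    and "x \<in> {dyadic n k..dyadic n (Suc k)}" "k < 2 ^ n"
  shows "\<bar>f x - f (dyadic n k)\<bar> \<le> \<bar>incr f n k\<bar> + tail f n / 2"
    and "\<bar>f (dyadic n (Suc k)) - f x\<bar> \<le> \<bar>incr f n k\<bar> + tail f n / 2"
proof -
  define u where "u = (x - dyadic n k) * 2 ^ n"
  have u: "0 \<le> u" "u \<le> 1"
    using assms(3) by (auto simp: u_def dyadic_Suc field_simps)
  have le: "\<bar>v * incr f n k\<bar> \<le> \<bar>incr f n k\<bar>" if "\<bar>v\<bar> \<le> 1" for v
    using mult_right_mono[OF that, of "\<bar>incr f n k\<bar>"] by (simp add: abs_mult)
  have "interp f n k x = f (dyadic n k) + u * incr f n k"
    by (simp add: interp_def u_def)
  moreover have "interp f n k x = f (dyadic n (Suc k)) + (u - 1) * incr f n k"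
    by (simp add: interp_def u_def incr_def algebra_simps)
  moreover have "\<bar>u * incr f n k\<bar> \<le> \<bar>incr f n k\<bar>" "\<bar>(u - 1) * incr f n k\<bar> \<le> \<bar>incr f n k\<bar>"
    using le[of u] le[of "u - 1"] u by auto
  moreover note interp_error_le_tail[OF assms]
  ultimately show "\<bar>f x - f (dyadic n k)\<bar> \<le> \<bar>incr f n k\<bar> + tail f n / 2"
    and "\<bar>f (dyadic n (Suc k)) - f x\<bar> \<le> \<bar>incr f n k\<bar> + tail f n / 2"
    by linarith+
qed

section \<open>Finite energy makes the Loeve bounds finite\<close>

text \<open>
  A real number, so that it can enter ordinary inequalities; on the energy space the bound
  is finite and nothing is lost.
\<close>

definition loeve :: "real \<Rightarrow> (real \<Rightarrow> real) \<Rightarrow> nat \<Rightarrow> real" where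
  "loeve r h N = enn2real (lp_norm_on r {N..} (\<lambda>n. ennreal \<bar>averaged_energy r h n\<bar>))
     + enn2real (lp_norm_on r {N..} (schauder_tail h)) / 2"

text \<open>
  The common bound for one factor of the Hoelder estimate at level \<open>m\<close>; half of
  the averaged energy accounts for complete half-intervals, half of the tail for the single
  cut one.
\<close>

definition level_weight :: "real \<Rightarrow> (real \<Rightarrow> real) \<Rightarrow> nat \<Rightarrow> real" where
  "level_weight r h m = averaged_energy r h m / 2 + tail h m / 2"

lemma level_weight_nonneg: "0 \<le> level_weight r h m"
  by (simp add: level_weight_def averaged_energy_nonneg tail_nonneg)

lemma loeve_nonneg: "0 \<le> loeve r h N"
  by (simp add: loeve_def)

lemma energy_space_finite:
  assumes "h \<in> energy_space r"
  shows "continuous_on {0..1} h"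
    and "lp_norm_on r {- 1..} (\<lambda>n. ennreal (level_energy r h n)) < \<infinity>"
    and "lp_norm_on r UNIV (schauder_tail h) < \<infinity>"
  using assms by (auto simp: energy_space_def energy_norm_def)

lemma schauder_tail_finite:
  assumes "r > 1" "h \<in> energy_space r"
  shows "schauder_tail h n < \<infinity>"
  using lp_norm_onD(1)[OF _ energy_space_finite(3)[OF assms(2)], of n] assms by simp

text \<open>
  A finite subset of the levels lies in an initial segment, where the recursion bounds the
  norm uniformly.
\<close>

lemma averaged_energy_norm_finite:
  assumes "r > 1" "h \<in> energy_space r"
  shows "lp_norm_on r {N..} (\<lambda>n. ennreal \<bar>averaged_energy r h n\<bar>) < \<infinity>"
proof -
  define Z where "Z = enn2real (lp_norm_on r {- 1..} (\<lambda>n. ennreal (level_energy r h n)))"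
  define C where "C = (decay r * level_energy r h (- 1) + Z) / (1 - decay r)"
  have Z: "fin_norm r {..M} (\<lambda>n. level_energy r h (int n)) \<le> Z" for M
  proof -
    have "fin_norm r (int ` {..M}) (\<lambda>n. enn2real (ennreal (level_energy r h n))) \<le> Z"
      unfolding Z_def using assms energy_space_finite(2)[OF assms(2)]
      by (intro lp_norm_onD(2)) auto
    then show ?thesis
      by (simp add: fin_norm_reindex level_energy_nonneg)
  qed
  have C: "fin_norm r {..M} (averaged_energy r h) \<le> C" for M
    unfolding C_def using fin_norm_averaged_energy_le[OF assms(1) Z] .
  have "lp_norm_on r {N..} (\<lambda>n. ennreal \<bar>averaged_energy r h n\<bar>) \<le> ennreal C"
  proof (rule lp_norm_on_le)
    show "0 \<le> C"
      using C[of 0] fin_norm_nonneg order_trans by blast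
  next
    fix F :: "nat set" assume "finite F"
    then obtain M where "F \<subseteq> {..M}"
      using finite_nat_iff_bounded_le by auto
    then have "fin_norm r F (averaged_energy r h) \<le> C"
      using fin_norm_mono_set[of r "{..M}" F "averaged_energy r h"] C[of M] assms by simp
    then show "fin_norm r F (\<lambda>n. \<bar>averaged_energy r h n\<bar>) \<le> C"
      by (simp add: fin_norm_def)
  qed (use assms in auto)
  then show ?thesis
    using ennreal_less_top order_le_less_trans by fastforce
qed

lemma tail_norm_finite:
  assumes "r > 1" "h \<in> energy_space r"
  shows "lp_norm_on r {N..} (schauder_tail h) < \<infinity>"
  using lp_norm_on_mono_set[of r "{N..}" UNIV "schauder_tail h"]
    energy_space_finite(3)[OF assms(2)] assms(1) by (simp add: order_le_less_trans)

lemma loeve_bound_eq: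
  assumes "r > 1" "h \<in> energy_space r"
  shows "loeve_bound r h N = ennreal (loeve r h N)"
proof -
  obtain a b where "lp_norm_on r {N..} (\<lambda>n. ennreal \<bar>averaged_energy r h n\<bar>) = ennreal a" "0 \<le> a"
      "lp_norm_on r {N..} (schauder_tail h) = ennreal b" "0 \<le> b"
    using averaged_energy_norm_finite[OF assms, of N] tail_norm_finite[OF assms, of N]
    by (metis ennreal_cases infinity_ennreal_def less_irrefl)
  then show ?thesis
    using divide_ennreal[of b 2] by (simp add: loeve_bound_def loeve_def ennreal_plus)
qed

lemma fin_norm_averaged_energy_tail_le:
  assumes "r > 1" "h \<in> energy_space r" "finite F" "F \<subseteq> {N..}"
  shows "fin_norm r F (averaged_energy r h) + fin_norm r F (tail h) / 2 \<le> loeve r h N"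
proof -
  have "fin_norm r F (\<lambda>n. enn2real (ennreal \<bar>averaged_energy r h n\<bar>))
      \<le> enn2real (lp_norm_on r {N..} (\<lambda>n. ennreal \<bar>averaged_energy r h n\<bar>))"
    using assms averaged_energy_norm_finite[OF assms(1,2)] by (intro lp_norm_onD(2)) auto
  moreover have "fin_norm r F (tail h) \<le> enn2real (lp_norm_on r {N..} (schauder_tail h))"
    unfolding tail_def using assms tail_norm_finite[OF assms(1,2)] by (intro lp_norm_onD(2)) auto
  ultimately show ?thesis
    by (simp add: loeve_def fin_norm_def)
qed

lemma fin_norm_level_weight_le:
  assumes "r > 1" "h \<in> energy_space r" "finite F" "F \<subseteq> {N..}"
  shows "fin_norm r F (level_weight r h) \<le> loeve r h N"
proof -
  have "fin_norm r F (level_weight r h)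
      \<le> fin_norm r F (\<lambda>m. 1 / 2 * averaged_energy r h m) + fin_norm r F (\<lambda>m. 1 / 2 * tail h m)"
    using Minkowski_sum[OF assms(1,3), of "\<lambda>m. 1 / 2 * averaged_energy r h m"
        "\<lambda>m. 1 / 2 * tail h m"] by (simp add: level_weight_def[abs_def])
  also have "\<dots> = fin_norm r F (averaged_energy r h) / 2 + fin_norm r F (tail h) / 2"
    using assms by (simp add: fin_norm_scale del: times_divide_eq_left)
  also have "\<dots> \<le> loeve r h N"
    using fin_norm_averaged_energy_tail_le[OF assms] fin_norm_nonneg[of r F "averaged_energy r h"]
    by linarith
  finally show ?thesis .
qed

text \<open>
  A single level is dominated by the norm over all levels from \<open>N\<close> on. This
  gives oscillation bounds at level \<open>N\<close> in terms of the Loeve bound.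
\<close>

lemma averaged_energy_plus_tail_le_loeve:
  assumes "r > 1" "h \<in> energy_space r"
  shows "averaged_energy r h N + tail h N / 2 \<le> loeve r h N"
  using fin_norm_averaged_energy_tail_le[OF assms, of "{N}" N] assms(1)
  by (simp add: fin_norm_def powr_powr averaged_energy_nonneg tail_nonneg)

text \<open>
  Hoelder's inequality across levels. Together with its use across the intervals of one
  level this is where conjugacy of the exponents enters.
\<close>

lemma sum_level_weights_le:
  assumes "p > 1" "q > 1" "1 / p + 1 / q = 1" "f \<in> energy_space p" "g \<in> energy_space q"
    and "finite F" "F \<subseteq> {N..}"
  shows "(\<Sum>m\<in>F. level_weight p f m * level_weight q g m) \<le> loeve p f N * loeve q g N"
proof -
  have "(\<Sum>m\<in>F. level_weight p f m * level_weight q g m)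
      \<le> fin_norm p F (level_weight p f) * fin_norm q F (level_weight q g)"
    using Hoelder_sum[OF assms(1-3,6), of "level_weight p f" "level_weight q g"]
    by (simp add: abs_mult level_weight_nonneg)
  also have "\<dots> \<le> loeve p f N * loeve q g N"
    using assms by (intro mult_mono fin_norm_level_weight_le) (auto simp: fin_norm_nonneg loeve_nonneg)
  finally show ?thesis .
qed

lemma summable_level_weights:
  assumes "p > 1" "q > 1" "1 / p + 1 / q = 1" "f \<in> energy_space p" "g \<in> energy_space q"
  shows "summable (\<lambda>m. level_weight p f m * level_weight q g m)"
  using sum_level_weights_le[OF assms, of "{..<_}" 0]
  by (intro summableI_nonneg_bounded[of _ "loeve p f 0 * loeve q g 0"])
    (auto simp: level_weight_nonneg)

section \<open>Left sums of clipped functions\<close>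

definition clip :: "real \<Rightarrow> real \<Rightarrow> real \<Rightarrow> real" where
  "clip s t x = max s (min t x)"

text \<open>
  The left sum over \<open>{0..1}\<close> of \<open>f\<close> and \<open>g\<close> frozen
  outside \<open>{s..t}\<close>. For a dyadic interval it is an ordinary left sum once the
  level is fine enough, but it makes sense, and depends continuously on the end points, for
  all real \<open>s\<close> and \<open>t\<close> at every level. This lets the estimates be
  proved at once for all real end points.
\<close>

definition clipped_sum ::
    "(real \<Rightarrow> real) \<Rightarrow> (real \<Rightarrow> real) \<Rightarrow> real \<Rightarrow> real \<Rightarrow> nat \<Rightarrow> real" where
  "clipped_sum f g s t m = (\<Sum>k<2 ^ m. f (clip s t (dyadic m k))
     * (g (clip s t (dyadic m (Suc k))) - g (clip s t (dyadic m k))))"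

text \<open>
  What one refinement adds to a clipped sum: a left increment of \<open>f\<close> times a
  right increment of \<open>g\<close> over each dyadic interval.
\<close>

definition clipped_step ::
    "(real \<Rightarrow> real) \<Rightarrow> (real \<Rightarrow> real) \<Rightarrow> real \<Rightarrow> real \<Rightarrow> nat \<Rightarrow> real" where
  "clipped_step f g s t m = (\<Sum>k<2 ^ m.
     (f (clip s t (dyadic (Suc m) (Suc (2 * k)))) - f (clip s t (dyadic m k)))
     * (g (clip s t (dyadic m (Suc k))) - g (clip s t (dyadic (Suc m) (Suc (2 * k))))))"

lemma clipped_sum_Suc: "clipped_sum f g s t (Suc m) = clipped_sum f g s t m + clipped_step f g s t m"
  unfolding clipped_sum_def clipped_step_def power_Suc sum_split_parity sum.distrib[symmetric]
    dyadic_double dyadic_double_Suc_Suc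
  by (intro sum.cong refl) (simp add: algebra_simps)

lemma clipped_sum_diff:
  "N \<le> M \<Longrightarrow> clipped_sum f g s t M = clipped_sum f g s t N + (\<Sum>m=N..<M. clipped_step f g s t m)"
  by (induction M rule: dec_induct) (auto simp: clipped_sum_Suc)

lemma floor_dyadic_eqI:
  assumes "dyadic m k \<le> x" "x < dyadic m (Suc k)"
  shows "nat \<lfloor>2 ^ m * x\<rfloor> = k"
proof -
  have "real k \<le> 2 ^ m * x" "2 ^ m * x < real k + 1"
    using assms by (auto simp: dyadic_def field_simps)
  then have "\<lfloor>2 ^ m * x\<rfloor> = int k"
    by (simp add: floor_eq_iff)
  then show ?thesis
    by simp
qed

text \<open>
  The correction stands for the one interval that is cut at an end point; in a power norm a
  single entry costs only its own size.
\<close>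

lemma fin_norm_single_correction_le:
  assumes "r > 1" "finite F" "0 \<le> c"
  shows "fin_norm r F (\<lambda>k. \<bar>a k\<bar> + (if k = j then c else 0)) \<le> fin_norm r F a + c"
proof -
  have "(\<Sum>k\<in>F. \<bar>if k = j then c else 0\<bar> powr r) = (\<Sum>k\<in>F. if k = j then c powr r else 0)"
    using assms by (intro sum.cong) auto
  also have "\<dots> \<le> c powr r"
    using assms by simp
  finally have "fin_norm r F (\<lambda>k. if k = j then c else 0) \<le> c"
    using assms by (subst fin_norm_le_iff) auto
  moreover have "fin_norm r F (\<lambda>k. \<bar>a k\<bar>) = fin_norm r F a"
    by (simp add: fin_norm_def)
  ultimately show ?thesis
    using Minkowski_sum[OF assms(1,2), of "\<lambda>k. \<bar>a k\<bar>" "\<lambda>k. if k = j then c else 0"] by linarith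
qed

text \<open>
  A summand vanishes unless the midpoint lies strictly between \<open>s\<close> and
  \<open>t\<close>. In a nonzero summand the left increment of \<open>f\<close> can only be
  cut by \<open>s\<close> and the right increment of \<open>g\<close> only by
  \<open>t\<close>, so each of the two factors has at most one cut entry per level.
  Hoelder's inequality within the level gives the bound.
\<close>

lemma abs_clipped_step_le:
  assumes "p > 1" "q > 1" "1 / p + 1 / q = 1" "f \<in> energy_space p" "g \<in> energy_space q"
    and st: "0 \<le> s" "s \<le> t" "t \<le> 1"
  shows "\<bar>clipped_step f g s t m\<bar> \<le> level_weight p f m * level_weight q g m"
proof -
  \<comment> \<open>The interval of level \<open>m\<close> that contains \<open>s\<close> has index \<open>nat \<lfloor>2 ^ m * s\<rfloor>\<close>.\<close>
  define u where "u k = \<bar>incr f (Suc m) (2 * k)\<bar>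
    + (if k = nat \<lfloor>2 ^ m * s\<rfloor> then tail f (Suc m) / 2 else 0)" for k
  define v where "v k = \<bar>incr g (Suc m) (Suc (2 * k))\<bar>
    + (if k = nat \<lfloor>2 ^ m * t\<rfloor> then tail g (Suc m) / 2 else 0)" for k
  note f = energy_space_finite(1)[OF assms(4)] schauder_tail_finite[OF assms(1,4)]
  note g = energy_space_finite(1)[OF assms(5)] schauder_tail_finite[OF assms(2,5)]
  have uv0: "0 \<le> u k" "0 \<le> v k" for k
    by (auto simp: u_def v_def tail_nonneg)
  have step: "\<bar>(f (clip s t (dyadic (Suc m) (Suc (2 * k)))) - f (clip s t (dyadic m k)))
      * (g (clip s t (dyadic m (Suc k))) - g (clip s t (dyadic (Suc m) (Suc (2 * k)))))\<bar>
      \<le> \<bar>u k * v k\<bar>" (is "\<bar>?a * ?b\<bar> \<le> _") if k: "k < 2 ^ m" for k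
  proof (cases "?a = 0 \<or> ?b = 0")
    case False
    let ?l = "dyadic m k" and ?m = "dyadic (Suc m) (Suc (2 * k))" and ?r = "dyadic m (Suc k)"
    have order: "?l < ?m" "?m < ?r"
      unfolding dyadic_midpoint dyadic_Suc[of m k] by (simp_all add: field_simps)
    have s: "s < ?m"
    proof (rule ccontr)
      assume "\<not> s < ?m"
      then have "clip s t ?m = s" "clip s t ?l = s"
        using order st by (auto simp: clip_def)
      then show False
        using False by simp
    qed
    have t: "?m < t"
    proof (rule ccontr)
      assume "\<not> ?m < t"
      then have "clip s t ?m = t" "clip s t ?r = t"
        using order st by (auto simp: clip_def)
      then show False
        using False by simp
    qed
    have "\<bar>?a\<bar> \<le> u k"
    proof (cases "s \<le> ?l")
      case True
      then have "?a = incr f (Suc m) (2 * k)"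
        using s t order by (simp add: clip_def incr_def)
      then show ?thesis
        by (simp add: u_def tail_nonneg)
    next
      case False
      then have "nat \<lfloor>2 ^ m * s\<rfloor> = k"
        using s order by (intro floor_dyadic_eqI) auto
      moreover have "?a = f ?m - f s"
        using False s t order by (simp add: clip_def)
      moreover have "\<bar>f ?m - f s\<bar> \<le> \<bar>incr f (Suc m) (2 * k)\<bar> + tail f (Suc m) / 2"
        using False s k by (intro endpoint_deviation_le(2) f) auto
      ultimately show ?thesis
        by (simp add: u_def)
    qed
    moreover have "\<bar>?b\<bar> \<le> v k"
    proof (cases "?r \<le> t")
      case True
      then have "?b = incr g (Suc m) (Suc (2 * k))"
        using s t order by (simp add: clip_def incr_def)
      then show ?thesis
        by (simp add: v_def tail_nonneg)
    next
      case False
      then have "nat \<lfloor>2 ^ m * t\<rfloor> = k"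
        using t order by (intro floor_dyadic_eqI) auto
      moreover have "?b = g t - g ?m"
        using False s t order st by (simp add: clip_def)
      moreover have "\<bar>g t - g ?m\<bar> \<le> \<bar>incr g (Suc m) (Suc (2 * k))\<bar> + tail g (Suc m) / 2"
        using False t k by (intro endpoint_deviation_le(1) g) auto
      ultimately show ?thesis
        by (simp add: v_def)
    qed
    ultimately show ?thesis
      unfolding abs_mult using uv0[of k] by (intro mult_mono) auto
  qed (auto simp: uv0)
  have u: "fin_norm p {..<2 ^ m} u \<le> level_weight p f m"
    using fin_norm_single_correction_le[OF assms(1), of "{..<2 ^ m}" "tail f (Suc m) / 2"
        "\<lambda>k. incr f (Suc m) (2 * k)" "nat \<lfloor>2 ^ m * s\<rfloor>"]
      fin_norm_half_incr_le(1)[OF assms(1), of m f] tail_antimono[OF f(2), of m "Suc m"]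
    by (simp add: u_def[abs_def] level_weight_def tail_nonneg)
  have v: "fin_norm q {..<2 ^ m} v \<le> level_weight q g m"
    using fin_norm_single_correction_le[OF assms(2), of "{..<2 ^ m}" "tail g (Suc m) / 2"
        "\<lambda>k. incr g (Suc m) (Suc (2 * k))" "nat \<lfloor>2 ^ m * t\<rfloor>"]
      fin_norm_half_incr_le(2)[OF assms(2), of m g] tail_antimono[OF g(2), of m "Suc m"]
    by (simp add: v_def[abs_def] level_weight_def tail_nonneg)
  have "\<bar>clipped_step f g s t m\<bar> \<le> (\<Sum>k<2 ^ m. \<bar>u k * v k\<bar>)"
    unfolding clipped_step_def using step by (intro order_trans[OF sum_abs] sum_mono) auto
  also have "\<dots> \<le> fin_norm p {..<2 ^ m} u * fin_norm q {..<2 ^ m} v"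
    using assms by (intro Hoelder_sum) auto
  also have "\<dots> \<le> level_weight p f m * level_weight q g m"
    using u v by (intro mult_mono) (auto simp: fin_norm_nonneg level_weight_nonneg)
  finally show ?thesis .
qed

lemma abs_clipped_sum_diff_le:
  assumes "p > 1" "q > 1" "1 / p + 1 / q = 1" "f \<in> energy_space p" "g \<in> energy_space q"
    and st: "0 \<le> s" "s \<le> t" "t \<le> 1" and "N \<le> M"
  shows "\<bar>clipped_sum f g s t M - clipped_sum f g s t N\<bar> \<le> loeve p f N * loeve q g N"
proof -
  have "\<bar>clipped_sum f g s t M - clipped_sum f g s t N\<bar>
      \<le> (\<Sum>m=N..<M. level_weight p f m * level_weight q g m)"
    using clipped_sum_diff[OF assms(9), of f g s t]
    by (auto intro!: order_trans[OF sum_abs] sum_mono abs_clipped_step_le[OF assms(1-8)])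
  also have "\<dots> \<le> loeve p f N * loeve q g N"
    by (intro sum_level_weights_le[OF assms(1-5)]) auto
  finally show ?thesis .
qed

lemma continuous_on_clipped_sum:
  assumes "continuous_on {0..1} f" "continuous_on {0..1} g"
  shows "continuous_on {0..1} (\<lambda>t. clipped_sum f g 0 t m)"
    and "continuous_on {0..1} (\<lambda>t. clipped_step f g 0 t m)"
proof -
  have *: "continuous_on {0..1} (\<lambda>t. h (clip 0 t x))" if "continuous_on {0..1} h" for h :: "real \<Rightarrow> real" and x
    by (rule continuous_on_compose2[OF that]) (auto simp: clip_def intro!: continuous_intros)
  show "continuous_on {0..1} (\<lambda>t. clipped_sum f g 0 t m)"
    unfolding clipped_sum_def by (intro continuous_intros * assms)
  show "continuous_on {0..1} (\<lambda>t. clipped_step f g 0 t m)"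
    unfolding clipped_step_def by (intro continuous_intros * assms)
qed

text \<open>
  The level weights dominate the refinement steps uniformly in \<open>t\<close>, so the
  continuous functions \<open>clipped_sum f g 0 t m\<close> converge uniformly. Their limit
  is the continuous extension of the dyadic integral.
\<close>

lemma clipped_sum_limit:
  assumes "p > 1" "q > 1" "1 / p + 1 / q = 1" "f \<in> energy_space p" "g \<in> energy_space q"
  obtains F where "continuous_on {0..1} F"
    "\<And>t. t \<in> {0..1} \<Longrightarrow> clipped_sum f g 0 t \<longlonglongrightarrow> F t"
proof -
  note cont = energy_space_finite(1)[OF assms(4)] energy_space_finite(1)[OF assms(5)]
  define G where "G t = (\<Sum>m. clipped_step f g 0 t m)" for t
  have u: "uniform_limit {0..1} (\<lambda>n t. \<Sum>m<n. clipped_step f g 0 t m) G sequentially"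
    unfolding G_def
    by (rule Weierstrass_m_test[OF _ summable_level_weights[OF assms]])
      (auto intro!: abs_clipped_step_le[OF assms])
  show thesis
  proof (rule that[of "\<lambda>t. clipped_sum f g 0 t 0 + G t"])
    have "continuous_on {0..1} G"
      by (intro uniform_limit_theorem[OF _ u] always_eventually allI continuous_on_sum
          continuous_on_clipped_sum(2) cont) simp
    then show "continuous_on {0..1} (\<lambda>t. clipped_sum f g 0 t 0 + G t)"
      by (intro continuous_intros continuous_on_clipped_sum cont)
  next
    fix t :: real assume "t \<in> {0..1}"
    then have "(\<lambda>n. clipped_sum f g 0 t 0 + (\<Sum>m<n. clipped_step f g 0 t m))
        \<longlonglongrightarrow> clipped_sum f g 0 t 0 + G t"
      by (intro tendsto_intros tendsto_uniform_limitI[OF u])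
    moreover have "clipped_sum f g 0 t 0 + (\<Sum>m<n. clipped_step f g 0 t m)
        = clipped_sum f g 0 t n" for n
      using clipped_sum_diff[of 0 n f g 0 t] by (simp add: atLeast0LessThan)
    ultimately show "clipped_sum f g 0 t \<longlonglongrightarrow> clipped_sum f g 0 t 0 + G t"
      by simp
  qed
qed

lemma endpoint_deviation_le_weight:
  assumes "r > 1" "h \<in> energy_space r" "x \<in> {dyadic n k..dyadic n (Suc k)}" "k < 2 ^ n"
  shows "\<bar>h x - h (dyadic n k)\<bar> \<le> averaged_energy r h n + tail h n / 2"
    and "\<bar>h (dyadic n (Suc k)) - h x\<bar> \<le> averaged_energy r h n + tail h n / 2"
  using endpoint_deviation_le[OF energy_space_finite(1)[OF assms(2)]
      schauder_tail_finite[OF assms(1,2)] assms(3,4)]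
    abs_incr_le[OF assms(1,4), of h] by simp_all

text \<open>
  For a non-dyadic \<open>s\<close> additivity may fail at a finite level, but only in the
  one interval that contains \<open>s\<close>, by the product of an increment of
  \<open>f\<close> and one of \<open>g\<close> over parts of that interval. This is bounded
  by level weights, whose products tend to zero.
\<close>

lemma clipped_sum_additive:
  assumes "p > 1" "q > 1" "1 / p + 1 / q = 1" "f \<in> energy_space p" "g \<in> energy_space q"
    and st: "0 \<le> s" "s \<le> t" "t \<le> 1"
  shows "(\<lambda>m. clipped_sum f g 0 t m - clipped_sum f g 0 s m - clipped_sum f g s t m) \<longlonglongrightarrow> 0"
proof (rule tendsto_rabs_zero_cancel, rule tendsto_sandwich)
  show "\<forall>\<^sub>F m in sequentially.
      0 \<le> \<bar>clipped_sum f g 0 t m - clipped_sum f g 0 s m - clipped_sum f g s t m\<bar>"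
    by simp
next
  show "(\<lambda>m. 8 * (level_weight p f m * level_weight q g m)) \<longlonglongrightarrow> 0"
    using summable_LIMSEQ_zero[OF summable_level_weights[OF assms(1-5)]]
    by (auto intro: tendsto_mult_right_zero)
next
  have "\<bar>clipped_sum f g 0 t m - clipped_sum f g 0 s m - clipped_sum f g s t m\<bar>
      \<le> 8 * (level_weight p f m * level_weight q g m)" for m
  proof -
    define W where "W = level_weight p f m * level_weight q g m"
    have W0: "0 \<le> W"
      by (simp add: W_def level_weight_nonneg)
    define d where "d k =
        f (clip 0 t (dyadic m k)) * (g (clip 0 t (dyadic m (Suc k))) - g (clip 0 t (dyadic m k)))
      - f (clip 0 s (dyadic m k)) * (g (clip 0 s (dyadic m (Suc k))) - g (clip 0 s (dyadic m k)))
      - f (clip s t (dyadic m k)) * (g (clip s t (dyadic m (Suc k))) - g (clip s t (dyadic m k)))"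
      for k
    define j where "j = nat \<lfloor>2 ^ m * s\<rfloor>"
    \<comment> \<open>Unless \<open>s\<close> cuts the interval, one of the last two summands vanishes and the other cancels the first.\<close>
    have zero: "d k = 0" if "\<not> (dyadic m k < s \<and> s < dyadic m (Suc k))" for k
    proof (cases "s \<le> dyadic m k")
      case True
      then have "clip 0 s (dyadic m k) = s" "clip 0 s (dyadic m (Suc k)) = s"
        "clip s t (dyadic m k) = clip 0 t (dyadic m k)"
        "clip s t (dyadic m (Suc k)) = clip 0 t (dyadic m (Suc k))"
        using st dyadic_mono[of k "Suc k" m] by (auto simp: clip_def)
      then show ?thesis
        by (simp add: d_def)
    next
      case False
      then have "dyadic m (Suc k) \<le> s"
        using that by simp
      then have "clip 0 s (dyadic m k) = clip 0 t (dyadic m k)"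
        "clip 0 s (dyadic m (Suc k)) = clip 0 t (dyadic m (Suc k))"
        "clip s t (dyadic m k) = s" "clip s t (dyadic m (Suc k)) = s"
        using st dyadic_mono[of k "Suc k" m] by (auto simp: clip_def)
      then show ?thesis
        by (simp add: d_def)
    qed
    have bound: "\<bar>d k\<bar> \<le> (if k = j then 8 * W else 0)" if "k < 2 ^ m" for k
    proof (cases "dyadic m k < s \<and> s < dyadic m (Suc k)")
      case True
      let ?l = "dyadic m k" and ?r = "dyadic m (Suc k)"
      have "j = k"
        unfolding j_def using True by (intro floor_dyadic_eqI) auto
      have "clip 0 s ?l = ?l" "clip 0 s ?r = s" "clip 0 t ?l = ?l" "clip 0 t ?r = min t ?r"
        "clip s t ?l = s" "clip s t ?r = min t ?r"
        using True st dyadic_nonneg[of m k] by (auto simp: clip_def)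
      then have "d k = (f ?l - f s) * (g (min t ?r) - g s)"
        by (simp add: d_def algebra_simps)
      moreover have "\<bar>f ?l - f s\<bar> \<le> 2 * level_weight p f m"
        using endpoint_deviation_le_weight(1)[OF assms(1,4) _ that, of s] True tail_nonneg[of f m]
        by (simp add: level_weight_def)
      moreover have "\<bar>g (min t ?r) - g s\<bar> \<le> 4 * level_weight q g m"
        using endpoint_deviation_le_weight(1)[OF assms(2,5) _ that, of s]
          endpoint_deviation_le_weight(1)[OF assms(2,5) _ that, of "min t ?r"]
          True st tail_nonneg[of g m]
        by (simp add: level_weight_def)
      ultimately have "\<bar>d k\<bar> \<le> 2 * level_weight p f m * (4 * level_weight q g m)"
        by (simp only: abs_mult) (intro mult_mono, auto simp: level_weight_nonneg)
      then show ?thesis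
        by (simp add: \<open>j = k\<close> W_def)
    qed (use zero W0 in auto)
    have "\<bar>clipped_sum f g 0 t m - clipped_sum f g 0 s m - clipped_sum f g s t m\<bar>
        = \<bar>\<Sum>k<2 ^ m. d k\<bar>"
      by (simp add: clipped_sum_def d_def sum_subtractf)
    also have "\<dots> \<le> (\<Sum>k<2 ^ m. if k = j then 8 * W else 0)"
      using bound by (intro order_trans[OF sum_abs] sum_mono) auto
    also have "\<dots> \<le> 8 * W"
      using W0 by simp
    finally show ?thesis
      by (simp add: W_def)
  qed
  then show "\<forall>\<^sub>F m in sequentially.
      \<bar>clipped_sum f g 0 t m - clipped_sum f g 0 s m - clipped_sum f g s t m\<bar>
      \<le> 8 * (level_weight p f m * level_weight q g m)"
    by simp
qed simp

section \<open>The Faber--Schauder integral as a limit of clipped sums\<close>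

lemma dyadic_grid_mono:
  assumes "m \<le> n"
  shows "dyadic_grid m \<subseteq> dyadic_grid n"
proof
  fix t assume "t \<in> dyadic_grid m"
  then obtain k where k: "t = dyadic m k" "k \<le> 2 ^ m"
    by (auto simp: dyadic_grid_def)
  have pow: "(2::nat) ^ n = 2 ^ m * 2 ^ (n - m)" "(2::real) ^ n = 2 ^ m * 2 ^ (n - m)"
    using assms by (simp_all flip: power_add)
  have "t = dyadic n (k * 2 ^ (n - m))"
    unfolding k(1) dyadic_def pow(2) by simp
  moreover have "k * 2 ^ (n - m) \<le> 2 ^ n"
    unfolding pow(1) using k(2) by simp
  ultimately show "t \<in> dyadic_grid n"
    by (auto simp: dyadic_grid_def)
qed

lemma mem_dyadic_grid_level:
  assumes "t \<in> dyadics"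
  shows "t \<in> dyadic_grid (n + dyadic_level t)"
proof -
  obtain m where "t \<in> dyadic_grid m"
    using assms by (auto simp: dyadics_def)
  then have "t \<in> dyadic_grid (dyadic_level t)"
    unfolding dyadic_level_def by (rule LeastI)
  then show ?thesis
    using dyadic_grid_mono[of "dyadic_level t" "n + dyadic_level t"] by auto
qed

lemma dyadics_subset: "dyadics \<subseteq> {0..1}"
  by (auto simp: dyadics_def dyadic_grid_def dyadic_nonneg dyadic_le_1)

lemma floor_dyadic: "nat \<lfloor>2 ^ n * dyadic n k\<rfloor> = k"
  by (intro floor_dyadic_eqI) (auto simp: dyadic_Suc)

lemma clip_unit_ends:
  assumes "0 \<le> s" "s \<le> t" "t \<le> 1"
  shows "clip s t (dyadic m 0) = s" "clip s t (dyadic m (2 ^ m)) = t"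
  using assms by (auto simp: clip_def dyadic_def)

text \<open>
  At a dyadic point of level at most \<open>m\<close> clipping cuts no interval and merely
  kills the increments to the right of \<open>t\<close>.
\<close>

lemma dyadic_left_sum_eq_clipped_sum:
  assumes "t \<in> dyadic_grid m"
  shows "dyadic_left_sum f g t m = clipped_sum f g 0 t m"
proof -
  obtain j where j: "t = dyadic m j" "j \<le> 2 ^ m"
    using assms by (auto simp: dyadic_grid_def)
  have below: "clip 0 t (dyadic m k) = dyadic m k" if "k \<le> j" for k
    using that dyadic_mono[of k j m] dyadic_nonneg[of m k] by (simp add: clip_def j)
  have above: "clip 0 t (dyadic m k) = t" if "j \<le> k" for k
    using that dyadic_mono[of j k m] dyadic_nonneg[of m j] by (simp add: clip_def j)
  have "clipped_sum f g 0 t m = (\<Sum>k<j. f (clip 0 t (dyadic m k))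
      * (g (clip 0 t (dyadic m (Suc k))) - g (clip 0 t (dyadic m k))))"
    unfolding clipped_sum_def using j above by (intro sum.mono_neutral_right) auto
  also have "\<dots> = dyadic_left_sum f g t m"
    unfolding dyadic_left_sum_def j(1) floor_dyadic unfolding j(1)[symmetric]
    by (intro sum.cong) (auto simp: below)
  finally show ?thesis ..
qed

lemma dyadic_integral_eqI:
  assumes "t \<in> dyadics" "clipped_sum f g 0 t \<longlonglongrightarrow> L"
  shows "dyadic_integral_exists f g t" "dyadic_integral f g t = L"
proof -
  have "(\<lambda>n. dyadic_left_sum f g t (n + dyadic_level t)) \<longlonglongrightarrow> L"
    using LIMSEQ_ignore_initial_segment[OF assms(2), of "dyadic_level t"]
    by (simp add: dyadic_left_sum_eq_clipped_sum mem_dyadic_grid_level[OF assms(1)])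
  then show "dyadic_integral_exists f g t" "dyadic_integral f g t = L"
    by (auto simp: dyadic_integral_exists_def dyadic_integral_def convergentI limI)
qed

lemma dyadic_integral_LIMSEQ:
  assumes "fs_integral_exists f g" "t \<in> dyadics"
  shows "(\<lambda>n. dyadic_left_sum f g t (n + dyadic_level t)) \<longlonglongrightarrow> dyadic_integral f g t"
  using assms
  by (simp add: fs_integral_exists_def dyadic_integral_exists_def dyadic_integral_def convergent_LIMSEQ_iff)

lemma dyadic_approx:
  assumes "t \<in> {0..1::real}"
  obtains x where "\<And>n. x n \<in> dyadics" "x \<longlonglongrightarrow> t"
proof
  let ?x = "\<lambda>n. dyadic n (nat \<lfloor>2 ^ n * t\<rfloor>)"
  have le: "real (nat \<lfloor>2 ^ n * t\<rfloor>) \<le> 2 ^ n * t" for n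
    using assms by (simp add: of_nat_nat)
  show "?x n \<in> dyadics" for n
  proof -
    have "2 ^ n * t \<le> 2 ^ n * 1"
      using assms by (intro mult_left_mono) auto
    then have "real (nat \<lfloor>2 ^ n * t\<rfloor>) \<le> 2 ^ n"
      using le[of n] by linarith
    then have "nat \<lfloor>2 ^ n * t\<rfloor> \<le> 2 ^ n"
      by (simp add: of_nat_le_iff[of _ "2 ^ n", simplified])
    then show ?thesis
      unfolding dyadics_def dyadic_grid_def by blast
  qed
  have lim: "(\<lambda>n. t - (1 / 2) ^ n) \<longlonglongrightarrow> t"
    using tendsto_diff[OF tendsto_const LIMSEQ_power_zero[of "1 / 2 :: real"], of t] by simp
  show "?x \<longlonglongrightarrow> t"
  proof (rule tendsto_sandwich[OF _ _ lim tendsto_const])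
    have "t - (1 / 2) ^ n \<le> ?x n" for n
    proof -
      have "2 ^ n * t - 1 \<le> real (nat \<lfloor>2 ^ n * t\<rfloor>)"
        using assms real_of_int_floor_add_one_gt[of "2 ^ n * t"] by (simp add: of_nat_nat)
      then have "(2 ^ n * t - 1) / 2 ^ n \<le> ?x n"
        unfolding dyadic_def by (intro divide_right_mono) auto
      moreover have "(2 ^ n * t - 1) / 2 ^ n = t - (1 / 2) ^ n"
        by (simp add: field_simps power_one_over)
      ultimately show ?thesis
        by simp
    qed
    then show "\<forall>\<^sub>F n in sequentially. t - (1 / 2) ^ n \<le> ?x n"
      by simp
    have "?x n \<le> t" for n
      using divide_right_mono[OF le[of n], of "2 ^ n"] by (simp add: dyadic_def)
    then show "\<forall>\<^sub>F n in sequentially. ?x n \<le> t"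
      by simp
  qed
qed

text \<open>
  This makes the continuous extension unique on \<open>{0..1}\<close> and thereby identifies
  the function chosen in \<open>fs_integral\<close>.
\<close>

lemma continuous_eq_if_eq_on_dyadics:
  fixes F G :: "real \<Rightarrow> real"
  assumes "continuous_on {0..1} F" "continuous_on {0..1} G"
    and "\<And>t. t \<in> dyadics \<Longrightarrow> F t = G t" and "t \<in> {0..1}"
  shows "F t = G t"
proof -
  obtain x where x: "\<And>n. x n \<in> dyadics" "x \<longlonglongrightarrow> t"
    using dyadic_approx[OF assms(4)] by blast
  have mem: "\<forall>\<^sub>F n in sequentially. x n \<in> {0..1}"
    using x(1) dyadics_subset by (intro always_eventually allI) blast
  have "(\<lambda>n. F (x n)) \<longlonglongrightarrow> F t" "(\<lambda>n. G (x n)) \<longlonglongrightarrow> G t"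
    by (rule continuous_on_tendsto_compose[OF assms(1) x(2) assms(4) mem],
        rule continuous_on_tendsto_compose[OF assms(2) x(2) assms(4) mem])
  then show ?thesis
    using x(1) assms(3) LIMSEQ_unique by simp
qed

lemma fs_integral_extends:
  assumes "fs_integral_exists f g"
  shows "continuous_on {0..1} (fs_integral f g)"
    and "t \<in> dyadics \<Longrightarrow> fs_integral f g t = dyadic_integral f g t"
proof -
  have "continuous_dyadic_extension f g (fs_integral f g)"
    using assms someI_ex[of "continuous_dyadic_extension f g"]
    by (simp add: fs_integral_exists_def fs_integral_def)
  then show "continuous_on {0..1} (fs_integral f g)"
    "t \<in> dyadics \<Longrightarrow> fs_integral f g t = dyadic_integral f g t"
    by (auto simp: continuous_dyadic_extension_def)
qed

lemma fs_integral_eqI: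
  assumes "continuous_on {0..1} F"
    and "\<And>t. t \<in> dyadics \<Longrightarrow> dyadic_integral_exists f g t"
    and "\<And>t. t \<in> dyadics \<Longrightarrow> dyadic_integral f g t = F t"
  shows "fs_integral_exists f g" and "t \<in> {0..1} \<Longrightarrow> fs_integral f g t = F t"
proof -
  show ex: "fs_integral_exists f g"
    using assms by (auto simp: fs_integral_exists_def continuous_dyadic_extension_def)
  show "fs_integral f g t = F t" if "t \<in> {0..1}"
  proof (rule continuous_eq_if_eq_on_dyadics[OF fs_integral_extends(1)[OF ex] assms(1) _ that])
    fix t assume "t \<in> dyadics"
    then show "fs_integral f g t = F t"
      using fs_integral_extends(2)[OF ex] assms(3) by metis
  qed
qed

theorem fs_integral_exists_conjugate:
  assumes "p > 1" "q > 1" "1 / p + 1 / q = 1" "f \<in> energy_space p" "g \<in> energy_space q"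
  shows "fs_integral_exists f g"
    and "t \<in> {0..1} \<Longrightarrow> clipped_sum f g 0 t \<longlonglongrightarrow> fs_integral f g t"
proof -
  obtain F where F: "continuous_on {0..1} F"
    "\<And>t. t \<in> {0..1} \<Longrightarrow> clipped_sum f g 0 t \<longlonglongrightarrow> F t"
    using clipped_sum_limit[OF assms] by blast
  have dyadic: "dyadic_integral_exists f g t" "dyadic_integral f g t = F t" if "t \<in> dyadics" for t
    using dyadic_integral_eqI[OF that F(2)] that dyadics_subset by auto
  note * = fs_integral_eqI[OF F(1) dyadic]
  show "fs_integral_exists f g"
    using * by blast
  show "clipped_sum f g 0 t \<longlonglongrightarrow> fs_integral f g t" if "t \<in> {0..1}"
    using F(2)[OF that] *(2)[OF _ _ that] by simp
qed

section \<open>Bilinearity and integration by parts\<close>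

text \<open>
  Any linear relation between left sums survives both the limit and the continuous
  extension. Stated for arbitrary pairs, this covers linearity in either argument.
\<close>

lemma fs_integral_linear_combination:
  assumes "fs_integral_exists f1 g1" "fs_integral_exists f2 g2"
    and sum: "\<And>t n. dyadic_left_sum f g t n
      = \<alpha> * dyadic_left_sum f1 g1 t n + \<beta> * dyadic_left_sum f2 g2 t n"
  shows "fs_integral_exists f g"
    and "t \<in> {0..1} \<Longrightarrow> fs_integral f g t = \<alpha> * fs_integral f1 g1 t + \<beta> * fs_integral f2 g2 t"
proof -
  let ?F = "\<lambda>t. \<alpha> * fs_integral f1 g1 t + \<beta> * fs_integral f2 g2 t"
  have cont: "continuous_on {0..1} ?F"
    by (intro continuous_intros fs_integral_extends(1) assms)
  have "dyadic_integral_exists f g t \<and> dyadic_integral f g t = ?F t" if "t \<in> dyadics" for t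
  proof -
    have "(\<lambda>n. dyadic_left_sum f g t (n + dyadic_level t)) \<longlonglongrightarrow> ?F t"
      unfolding sum fs_integral_extends(2)[OF assms(1) that] fs_integral_extends(2)[OF assms(2) that]
      by (intro tendsto_intros dyadic_integral_LIMSEQ assms that)
    then show ?thesis
      by (auto simp: dyadic_integral_exists_def dyadic_integral_def convergentI limI)
  qed
  then show "fs_integral_exists f g" "t \<in> {0..1} \<Longrightarrow> fs_integral f g t = ?F t"
    using fs_integral_eqI[OF cont] by blast+
qed

lemma dyadic_left_sum_linear:
  "dyadic_left_sum (\<lambda>x. \<alpha> * f x + \<beta> * f2 x) g t n
    = \<alpha> * dyadic_left_sum f g t n + \<beta> * dyadic_left_sum f2 g t n"
  "dyadic_left_sum f (\<lambda>x. \<alpha> * g x + \<beta> * g2 x) t n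
    = \<alpha> * dyadic_left_sum f g t n + \<beta> * dyadic_left_sum f g2 t n"
  by (auto simp: dyadic_left_sum_def sum_distrib_left algebra_simps sum.distrib sum_subtractf)

text \<open>
  Discrete integration by parts: the defect is the discrete bracket, the sum of the products
  of increments.
\<close>

lemma dyadic_left_sum_swap:
  assumes "t \<in> dyadic_grid n"
  shows "dyadic_left_sum f g t n + dyadic_left_sum g f t n
    = f t * g t - f 0 * g 0 - (\<Sum>k<nat \<lfloor>2 ^ n * t\<rfloor>. incr f n k * incr g n k)"
proof -
  obtain j where j: "t = dyadic n j" "j \<le> 2 ^ n"
    using assms by (auto simp: dyadic_grid_def)
  define h where "h k = f (dyadic n k) * g (dyadic n k)" for k
  have "dyadic_left_sum f g t n + dyadic_left_sum g f t n
      + (\<Sum>k<nat \<lfloor>2 ^ n * t\<rfloor>. incr f n k * incr g n k) = (\<Sum>k<j. h (Suc k) - h k)"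
    unfolding dyadic_left_sum_def j(1) floor_dyadic sum.distrib[symmetric]
    by (intro sum.cong) (auto simp: h_def incr_def algebra_simps)
  also have "\<dots> = h j - h 0"
    by (rule sum_lessThan_telescope)
  also have "\<dots> = f t * g t - f 0 * g 0"
    by (simp add: h_def j(1) dyadic_def)
  finally show ?thesis
    by simp
qed

text \<open>
  The discrete bracket is bounded by products of level weights and hence vanishes in the
  limit, which is why the integral obeys the classical formula with no correction term.
\<close>

lemma abs_sum_incr_mult_le:
  assumes "p > 1" "q > 1" "1 / p + 1 / q = 1" "j \<le> 2 ^ n"
  shows "\<bar>\<Sum>k<j. incr f n k * incr g n k\<bar> \<le> 4 * (level_weight p f n * level_weight q g n)"
proof -
  have "\<bar>\<Sum>k<j. incr f n k * incr g n k\<bar> \<le> (\<Sum>k<j. \<bar>incr f n k * incr g n k\<bar>)"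
    by (rule sum_abs)
  also have "\<dots> \<le> (\<Sum>k<2 ^ n. \<bar>incr f n k * incr g n k\<bar>)"
    using assms by (intro sum_mono2) auto
  also have "\<dots> \<le> fin_norm p {..<2 ^ n} (incr f n) * fin_norm q {..<2 ^ n} (incr g n)"
    using assms by (intro Hoelder_sum) auto
  also have "\<dots> \<le> (2 * level_weight p f n) * (2 * level_weight q g n)"
    using fin_norm_incr_le[OF assms(1), of n f] fin_norm_incr_le[OF assms(2), of n g]
      tail_nonneg[of f n] tail_nonneg[of g n]
    by (intro mult_mono) (auto simp: level_weight_def fin_norm_nonneg averaged_energy_nonneg)
  finally show ?thesis
    by simp
qed

theorem fs_integral_by_parts:
  assumes "p > 1" "q > 1" "1 / p + 1 / q = 1" "f \<in> energy_space p" "g \<in> energy_space q"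
    and "t \<in> {0..1}"
  shows "fs_integral f g t + fs_integral g f t = f t * g t - f 0 * g 0"
proof -
  have fg: "fs_integral_exists f g"
    using fs_integral_exists_conjugate(1)[OF assms(1-5)] .
  have gf: "fs_integral_exists g f"
    using fs_integral_exists_conjugate(1)[OF assms(2,1) _ assms(5,4)] assms(3) by simp
  note cont = energy_space_finite(1)[OF assms(4)] energy_space_finite(1)[OF assms(5)]
  show ?thesis
  proof (rule continuous_eq_if_eq_on_dyadics[OF _ _ _ assms(6)])
    show "continuous_on {0..1} (\<lambda>t. fs_integral f g t + fs_integral g f t)"
      by (intro continuous_intros fs_integral_extends(1) fg gf)
    show "continuous_on {0..1} (\<lambda>t. f t * g t - f 0 * g 0)"
      by (intro continuous_intros cont)
  next
    fix t assume t: "t \<in> dyadics"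
    define e where "e n = (\<Sum>k<nat \<lfloor>2 ^ n * t\<rfloor>. incr f n k * incr g n k)" for n
    define l where "l = dyadic_level t"
    have grid: "t \<in> dyadic_grid (n + l)" for n
      unfolding l_def using t by (rule mem_dyadic_grid_level)
    have "(\<lambda>n. 4 * (level_weight p f n * level_weight q g n)) \<longlonglongrightarrow> 0"
      using summable_LIMSEQ_zero[OF summable_level_weights[OF assms(1-5)]]
      by (auto intro: tendsto_mult_right_zero)
    then have lim: "(\<lambda>n. 4 * (level_weight p f (n + l) * level_weight q g (n + l))) \<longlonglongrightarrow> 0"
      by (rule LIMSEQ_ignore_initial_segment)
    have "(\<lambda>n. e (n + l)) \<longlonglongrightarrow> 0"
    proof (rule Lim_null_comparison[OF _ lim], intro always_eventually allI)
      fix n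
      obtain j where "t = dyadic (n + l) j" "j \<le> 2 ^ (n + l)"
        using grid[of n] by (auto simp: dyadic_grid_def)
      then show "norm (e (n + l)) \<le> 4 * (level_weight p f (n + l) * level_weight q g (n + l))"
        using abs_sum_incr_mult_le[OF assms(1-3), of j "n + l" f g] by (simp add: e_def floor_dyadic)
    qed
    then have "(\<lambda>n. f t * g t - f 0 * g 0 - e (n + l)) \<longlonglongrightarrow> f t * g t - f 0 * g 0 - 0"
      by (intro tendsto_intros)
    moreover have "(\<lambda>n. dyadic_left_sum f g t (n + l) + dyadic_left_sum g f t (n + l))
        \<longlonglongrightarrow> dyadic_integral f g t + dyadic_integral g f t"
      unfolding l_def by (intro tendsto_add dyadic_integral_LIMSEQ fg gf t)
    ultimately show "fs_integral f g t + fs_integral g f t = f t * g t - f 0 * g 0"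
      unfolding dyadic_left_sum_swap[OF grid] e_def
        fs_integral_extends(2)[OF fg t] fs_integral_extends(2)[OF gf t]
      using LIMSEQ_unique by fastforce
  qed
qed

section \<open>The Young--Loeve estimate\<close>

lemma abs_diff_grid_point_le:
  assumes "r > 1" "h \<in> energy_space r"
    and "x \<in> {0..1}" "j \<le> 2 ^ N" "\<bar>x - dyadic N j\<bar> \<le> 1 / 2 ^ N"
  shows "\<bar>h x - h (dyadic N j)\<bar> \<le> loeve r h N"
proof -
  consider "x = dyadic N j" | "dyadic N j < x" | "x < dyadic N j"
    by linarith
  then show ?thesis
  proof cases
    case 1
    then show ?thesis
      by (simp add: loeve_nonneg)
  next
    case 2
    have "j \<noteq> 2 ^ N"
      using 2 assms(3) by (auto simp: dyadic_def)
    then have "\<bar>h x - h (dyadic N j)\<bar> \<le> averaged_energy r h N + tail h N / 2"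
      using 2 assms by (intro endpoint_deviation_le_weight(1)) (auto simp: dyadic_Suc)
    then show ?thesis
      using averaged_energy_plus_tail_le_loeve[OF assms(1,2), of N] by linarith
  next
    case 3
    then obtain i where i: "j = Suc i"
      using assms(3) by (cases j) (auto simp: dyadic_def)
    have "\<bar>h (dyadic N (Suc i)) - h x\<bar> \<le> averaged_energy r h N + tail h N / 2"
      using 3 assms by (intro endpoint_deviation_le_weight(2)) (auto simp: dyadic_Suc i)
    then show ?thesis
      using averaged_energy_plus_tail_le_loeve[OF assms(1,2), of N] by (simp add: i abs_minus_commute)
  qed
qed

text \<open>
  At a level whose mesh is at least \<open>t - s\<close> the interval \<open>{s..t}\<close>
  overlaps at most two dyadic intervals, and every point involved is within one mesh of a
  common grid point. If a grid point \<open>c\<close> lies in \<open>{s..t}\<close>, the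
  clipped sum has the two terms over \<open>{s..c}\<close> and \<open>{c..t}\<close>, which
  contribute \<open>2\<close> and \<open>1\<close> to the constant; otherwise it has a
  single term, which contributes \<open>2 * 2\<close>.
\<close>

lemma abs_clipped_sum_coarse_le:
  assumes "p > 1" "q > 1" "f \<in> energy_space p" "g \<in> energy_space q"
    and "0 \<le> s" "s \<le> \<xi>" "\<xi> \<le> t" "t \<le> 1" "t - s \<le> 1 / 2 ^ N"
  shows "\<bar>clipped_sum f g s t N - f \<xi> * (g t - g s)\<bar> \<le> 4 * (loeve p f N * loeve q g N)"
proof -
  define G where "G k = g (clip s t (dyadic N k))" for k
  have G: "G 0 = g s" "G (2 ^ N) = g t"
    using clip_unit_ends[of s t N] assms by (auto simp: G_def)
  have sum_eq: "clipped_sum f g s t N = (\<Sum>k<2 ^ N. f (clip s t (dyadic N k)) * (G (Suc k) - G k))"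
    by (simp add: clipped_sum_def G_def)
  note L0 = loeve_nonneg[of p f N] loeve_nonneg[of q g N]
  note near_f = abs_diff_grid_point_le[OF assms(1,3), of _ _ N]
  note near_g = abs_diff_grid_point_le[OF assms(2,4), of _ _ N]
  show ?thesis
  proof (cases "\<exists>j\<le>2 ^ N. s \<le> dyadic N j \<and> dyadic N j \<le> t")
    case True
    then obtain j where j: "j \<le> 2 ^ N" "s \<le> dyadic N j" "dyadic N j \<le> t"
      by blast
    define c where "c = dyadic N j"
    have Gj: "G j = g c"
      using j by (simp add: G_def c_def clip_def)
    \<comment> \<open>Grid points other than \<open>c\<close> are at least one mesh away from \<open>c\<close>, hence outside the open interval.\<close>
    have left: "clip s t (dyadic N k) = s" if "k < j" for k
    proof -
      have "dyadic N k + 1 / 2 ^ N \<le> c"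
        using that dyadic_mono[of "Suc k" j N] by (simp add: dyadic_Suc c_def)
      then have "dyadic N k \<le> s"
        using j assms by (simp add: c_def)
      then show ?thesis
        using assms by (simp add: clip_def)
    qed
    have right: "clip s t (dyadic N k) = t" if "j < k" for k
    proof -
      have "c + 1 / 2 ^ N \<le> dyadic N k"
        using that dyadic_mono[of "Suc j" k N] by (simp add: dyadic_Suc c_def)
      then have "t \<le> dyadic N k"
        using j assms by (simp add: c_def)
      then show ?thesis
        using assms by (simp add: clip_def)
    qed
    have "clipped_sum f g s t N = (\<Sum>k<j. f s * (G (Suc k) - G k))
        + (\<Sum>k=j..<2 ^ N. f c * (G (Suc k) - G k))"
    proof -
      have "(\<Sum>k=j..<2 ^ N. f (clip s t (dyadic N k)) * (G (Suc k) - G k))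
          = (\<Sum>k=j..<2 ^ N. f c * (G (Suc k) - G k))"
      proof (intro sum.cong refl)
        fix k assume "k \<in> {j..<2 ^ N}"
        then consider "k = j" | "j < k"
          by fastforce
        then show "f (clip s t (dyadic N k)) * (G (Suc k) - G k) = f c * (G (Suc k) - G k)"
        proof cases
          case 1
          then show ?thesis
            using j by (simp add: clip_def c_def)
        next
          case 2
          then show ?thesis
            by (simp add: G_def right)
        qed
      qed
      moreover have "{..<2 ^ N} = {..<j} \<union> {j..<2 ^ N}" "{..<j} \<inter> {j..<2 ^ N} = {}"
        using j(1) by auto
      ultimately show ?thesis
        unfolding sum_eq by (simp add: sum.union_disjoint left)
    qed
    also have "\<dots> = f s * (g c - g s) + f c * (g t - g c)"
      using sum_lessThan_telescope[of G j] sum_Suc_diff'[OF j(1), of G]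
      by (simp add: G Gj flip: sum_distrib_left)
    finally have "clipped_sum f g s t N - f \<xi> * (g t - g s)
        = (f s - f \<xi>) * (g c - g s) + (f c - f \<xi>) * (g t - g c)"
      by (simp add: algebra_simps)
    also have "\<bar>\<dots>\<bar> \<le> 2 * loeve p f N * loeve q g N + loeve p f N * loeve q g N"
    proof -
      have s: "\<bar>f s - f c\<bar> \<le> loeve p f N" "\<bar>g s - g c\<bar> \<le> loeve q g N"
        unfolding c_def using j assms by (auto intro!: near_f near_g)
      have t: "\<bar>g t - g c\<bar> \<le> loeve q g N"
        unfolding c_def using j assms by (auto intro!: near_g)
      have \<xi>: "\<bar>f \<xi> - f c\<bar> \<le> loeve p f N"
        unfolding c_def using j assms by (auto intro!: near_f)
      have "\<bar>(f s - f \<xi>) * (g c - g s)\<bar> \<le> 2 * loeve p f N * loeve q g N"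
        unfolding abs_mult using s \<xi> L0 by (intro mult_mono) auto
      moreover have "\<bar>(f c - f \<xi>) * (g t - g c)\<bar> \<le> loeve p f N * loeve q g N"
        unfolding abs_mult using t \<xi> L0 by (intro mult_mono) auto
      ultimately show ?thesis
        by linarith
    qed
    finally show ?thesis
      using mult_nonneg_nonneg[OF L0] by simp
  next
    case False
    define k where "k = nat \<lfloor>2 ^ N * s\<rfloor>"
    have "real k \<le> 2 ^ N * s" "2 ^ N * s < real k + 1"
      using assms by (auto simp: k_def of_nat_nat)
    then have k: "dyadic N k \<le> s" "s < dyadic N (Suc k)"
      by (auto simp: dyadic_def field_simps)
    have "s < 1"
    proof (rule ccontr)
      assume "\<not> s < 1"
      then have "s \<le> dyadic N (2 ^ N) \<and> dyadic N (2 ^ N) \<le> t"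
        using assms by (simp add: dyadic_def)
      then show False
        using False by blast
    qed
    have k_less: "k < 2 ^ N"
    proof (rule ccontr)
      assume "\<not> k < 2 ^ N"
      then have "dyadic N (2 ^ N) \<le> dyadic N k"
        by (intro dyadic_mono) simp
      moreover have "dyadic N (2 ^ N) = 1"
        by (simp add: dyadic_def)
      ultimately show False
        using k(1) \<open>s < 1\<close> by linarith
    qed
    then have t: "t < dyadic N (Suc k)"
      using False k by (meson Suc_leI less_imp_le not_le)
    \<comment> \<open>Past index \<open>k\<close> both clipped end points are \<open>t\<close>, so the value of \<open>f\<close> there is immaterial.\<close>
    have const: "f (clip s t (dyadic N i)) * (G (Suc i) - G i) = f s * (G (Suc i) - G i)" for i
    proof (cases "i \<le> k")
      case True
      then have "dyadic N i \<le> s"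
        using dyadic_mono[of i k N] k by simp
      then show ?thesis
        using assms by (simp add: clip_def)
    next
      case False
      then have "t \<le> dyadic N i" "t \<le> dyadic N (Suc i)"
        using t dyadic_mono[of "Suc k" i N] dyadic_mono[of "Suc k" "Suc i" N] by auto
      then show ?thesis
        by (simp add: G_def clip_def)
    qed
    have "clipped_sum f g s t N = f s * (g t - g s)"
      unfolding sum_eq const sum_distrib_left[symmetric] sum_lessThan_telescope G ..
    then have "clipped_sum f g s t N - f \<xi> * (g t - g s) = (f s - f \<xi>) * (g t - g s)"
      by (simp add: algebra_simps)
    also have "\<bar>\<dots>\<bar> \<le> (2 * loeve p f N) * (2 * loeve q g N)"
    proof -
      have near: "\<bar>x - dyadic N k\<bar> \<le> 1 / 2 ^ N \<and> x \<in> {0..1}" if "x \<in> {s..t}" for x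
        using that k t assms by (auto simp: dyadic_Suc)
      have "\<bar>f s - f (dyadic N k)\<bar> \<le> loeve p f N" "\<bar>f \<xi> - f (dyadic N k)\<bar> \<le> loeve p f N"
        "\<bar>g s - g (dyadic N k)\<bar> \<le> loeve q g N" "\<bar>g t - g (dyadic N k)\<bar> \<le> loeve q g N"
        using near[of s] near[of \<xi>] near[of t] k_less assms by (auto intro!: near_f near_g)
      then show ?thesis
        unfolding abs_mult using L0 by (intro mult_mono) auto
    qed
    finally show ?thesis
      by simp
  qed
qed

text \<open>
  Compare the integral with the clipped sum at level \<open>N\<close>: all refinements
  beyond level \<open>N\<close> contribute \<open>1\<close> to the constant, and the coarse
  sum contributes \<open>4\<close>.
\<close>

theorem Young_Loeve_estimate:
  assumes "p > 1" "q > 1" "1 / p + 1 / q = 1" "f \<in> energy_space p" "g \<in> energy_space q"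
    and "0 \<le> s" "s \<le> \<xi>" "\<xi> \<le> t" "t \<le> 1" "t - s \<le> 1 / 2 ^ N"
  shows "\<bar>fs_int s t f g - f \<xi> * (g t - g s)\<bar> \<le> 5 * (loeve p f N * loeve q g N)"
proof -
  define c where "c m = clipped_sum f g s t m" for m
  have st: "s \<in> {0..1}" "t \<in> {0..1}" "s \<le> t"
    using assms by auto
  \<comment> \<open>The clipped sums over \<open>{s..t}\<close> converge to the integral because additivity holds in the limit.\<close>
  have "(\<lambda>m. (clipped_sum f g 0 t m - clipped_sum f g 0 s m)
      - (clipped_sum f g 0 t m - clipped_sum f g 0 s m - clipped_sum f g s t m))
      \<longlonglongrightarrow> (fs_integral f g t - fs_integral f g s) - 0"
    using st assms
    by (intro tendsto_diff fs_integral_exists_conjugate(2)[OF assms(1-5)] clipped_sum_additive[OF assms(1-5)]) auto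
  then have lim: "c \<longlonglongrightarrow> fs_int s t f g"
    by (simp add: fs_int_def c_def[abs_def])
  have "\<bar>fs_int s t f g - c N\<bar> \<le> loeve p f N * loeve q g N"
  proof (rule tendsto_upperbound)
    show "(\<lambda>m. \<bar>c m - c N\<bar>) \<longlonglongrightarrow> \<bar>fs_int s t f g - c N\<bar>"
      by (intro tendsto_intros lim)
    have "\<bar>c m - c N\<bar> \<le> loeve p f N * loeve q g N" if "m \<ge> N" for m
      unfolding c_def using that st assms by (intro abs_clipped_sum_diff_le[OF assms(1-5)]) auto
    then show "\<forall>\<^sub>F m in sequentially. \<bar>c m - c N\<bar> \<le> loeve p f N * loeve q g N"
      by (auto simp: eventually_sequentially)
  qed simp
  moreover have "\<bar>c N - f \<xi> * (g t - g s)\<bar> \<le> 4 * (loeve p f N * loeve q g N)"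
    unfolding c_def using assms by (intro abs_clipped_sum_coarse_le) auto
  ultimately show ?thesis
    by linarith
qed

section \<open>Inclusions between energy spaces\<close>

text \<open>
  The factor \<open>2\<close> is there for the level \<open>-1\<close>, whose weight
  \<open>2 powr (1 - 1 / q)\<close> grows with the exponent; at all other levels power norms
  decrease in it.
\<close>

lemma level_energy_exponent_le:
  assumes "1 < q" "q \<le> q'" "- 1 \<le> n"
  shows "level_energy q' h n \<le> 2 * level_energy q h n"
proof (cases "n = - 1")
  case True
  have "0 < 1 / q'" "1 / q < 1"
    using assms by simp_all
  then have "1 - 1 / q' \<le> 1 + (1 - 1 / q)"
    by linarith
  then have "(2::real) powr (1 - 1 / q') \<le> 2 powr (1 + (1 - 1 / q))"
    by (intro powr_mono) auto
  also have "\<dots> = 2 * 2 powr (1 - 1 / q)"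
    by (subst powr_add) simp
  finally show ?thesis
    using True mult_right_mono[of "2 powr (1 - 1 / q')" "2 * 2 powr (1 - 1 / q)" "\<bar>fs_coeff h (- 1) 0\<bar>"]
    by (simp add: level_energy_def)
next
  case False
  then have m: "n = int (nat n)"
    using assms(3) by simp
  have "level_energy q' h n \<le> level_energy q h n"
    using fin_norm_antimono_exponent[of q q' "{..<2 ^ nat n}" "kink h (nat n)"] assms
    by (subst (1 2) m) (simp add: level_energy_eq del: int_nat_eq)
  then show ?thesis
    using level_energy_nonneg[of q h n] by linarith
qed

lemma energy_space_mono:
  assumes "1 < q" "q \<le> q'" "h \<in> energy_space q"
  shows "h \<in> energy_space q'"
proof -
  define X where "X = enn2real (lp_norm_on q {- 1..} (\<lambda>n. ennreal (level_energy q h n)))"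
  have "lp_norm_on q' {- 1..} (\<lambda>n. ennreal (level_energy q' h n)) \<le> ennreal (2 * X)"
  proof (rule lp_norm_on_le)
    fix F :: "int set" assume F: "finite F" "F \<subseteq> {- 1..}"
    have "fin_norm q' F (level_energy q' h) \<le> fin_norm q' F (\<lambda>n. 2 * level_energy q h n)"
      using F assms level_energy_exponent_le[OF assms(1,2), of _ h]
      by (intro fin_norm_mono) (auto simp: level_energy_nonneg)
    also have "\<dots> = 2 * fin_norm q' F (level_energy q h)"
      using assms by (simp add: fin_norm_scale)
    also have "fin_norm q' F (level_energy q h) \<le> fin_norm q F (level_energy q h)"
      using assms F by (intro fin_norm_antimono_exponent) auto
    also have "fin_norm q F (level_energy q h) \<le> X"
      using lp_norm_onD(2)[OF _ energy_space_finite(2)[OF assms(3)] F] assms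
      by (simp add: X_def level_energy_nonneg)
    finally show "fin_norm q' F (level_energy q' h) \<le> 2 * X"
      by simp
  qed (use assms in \<open>auto simp: X_def level_energy_nonneg\<close>)
  then have "lp_norm_on q' {- 1..} (\<lambda>n. ennreal (level_energy q' h n)) < \<infinity>"
    using ennreal_less_top order_le_less_trans by fastforce
  moreover have "lp_norm_on q' UNIV (schauder_tail h) < \<infinity>"
    using lp_norm_on_antimono_exponent[OF _ assms(2) energy_space_finite(3)[OF assms(3)]] assms by simp
  ultimately show ?thesis
    using assms(3) by (auto simp: energy_space_def energy_norm_def)
qed

text \<open>
  Keep \<open>p\<close> and enlarge \<open>q\<close> to the conjugate exponent of
  \<open>p\<close>.
\<close>

lemma ex_conjugate_exponents:
  assumes "p > 1" "q > 1" "1 / p + 1 / q \<ge> 1" "f \<in> energy_space p" "g \<in> energy_space q"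
  shows "\<exists>p' q'. p' > 1 \<and> q' > 1 \<and> 1 / p' + 1 / q' = 1 \<and> p' \<ge> p \<and> q' \<ge> q
    \<and> f \<in> energy_space p' \<and> g \<in> energy_space q'"
proof -
  define q' where "q' = p / (p - 1)"
  have q': "q' > 1" "1 / p + 1 / q' = 1"
    using assms(1) by (auto simp: q'_def field_simps)
  have "1 / q' \<le> 1 / q"
    using q'(2) assms(3) by linarith
  then have "q \<le> q'"
    using q'(1) assms(2) by (simp add: field_simps)
  then show ?thesis
    using assms q' energy_space_mono[of q q' g] by blast
qed

theorem corollary3p22:
  fixes p q :: real and f g :: "real \<Rightarrow> real"
  assumes "p > 1" and "q > 1" and "1 / p + 1 / q \<ge> 1"
    and "f \<in> energy_space p" and "g \<in> energy_space q"
  shows "fs_integral_exists f g \<and> fs_integral_exists g f \<and>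
    (\<exists>p' q'. p' > 1 \<and> q' > 1 \<and> 1 / p' + 1 / q' = 1 \<and> p' \<ge> p \<and> q' \<ge> q \<and>
       f \<in> energy_space p' \<and> g \<in> energy_space q') \<and>
    (\<forall>p' q'. p' > 1 \<and> q' > 1 \<and> 1 / p' + 1 / q' = 1 \<and> p' \<ge> p \<and> q' \<ge> q \<and>
       f \<in> energy_space p' \<and> g \<in> energy_space q' \<longrightarrow>
       (\<forall>\<alpha> \<beta> f2. continuous_on {0..1} f2 \<and> fs_integral_exists f2 g \<longrightarrow>
          fs_integral_exists (\<lambda>x. \<alpha> * f x + \<beta> * f2 x) g \<and>
          (\<forall>t\<in>{0..1}. fs_integral (\<lambda>x. \<alpha> * f x + \<beta> * f2 x) g t
             = \<alpha> * fs_integral f g t + \<beta> * fs_integral f2 g t)) \<and>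
       (\<forall>\<alpha> \<beta> g2. continuous_on {0..1} g2 \<and> fs_integral_exists f g2 \<longrightarrow>
          fs_integral_exists f (\<lambda>x. \<alpha> * g x + \<beta> * g2 x) \<and>
          (\<forall>t\<in>{0..1}. fs_integral f (\<lambda>x. \<alpha> * g x + \<beta> * g2 x) t
             = \<alpha> * fs_integral f g t + \<beta> * fs_integral f g2 t)) \<and>
       (\<forall>r\<in>{0..1}. \<forall>s\<in>{0..1}. \<forall>t\<in>{0..1}.
          fs_int r t f g = fs_int r s f g + fs_int s t f g) \<and>
       (\<forall>s\<in>{0..1}. \<forall>t\<in>{0..1}.
          fs_int s t f g + fs_int s t g f = f t * g t - f s * g s) \<and>
       (\<forall>s \<xi> t N. 0 \<le> s \<and> s \<le> \<xi> \<and> \<xi> \<le> t \<and> t \<le> 1 \<and> t - s \<le> 1 / 2 ^ N \<longrightarrow>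
          ennreal \<bar>fs_int s t f g - f \<xi> * (g t - g s)\<bar>
            \<le> 8 * loeve_bound p' f N * loeve_bound q' g N))"
proof -
  obtain p0 q0 where conj0: "p0 > 1" "q0 > 1" "1 / p0 + 1 / q0 = 1"
      "f \<in> energy_space p0" "g \<in> energy_space q0"
    using ex_conjugate_exponents[OF assms] by blast
  have fg: "fs_integral_exists f g"
    using fs_integral_exists_conjugate(1)[OF conj0] .
  have gf: "fs_integral_exists g f"
    using fs_integral_exists_conjugate(1)[OF conj0(2,1) _ conj0(5,4)] conj0(3) by simp
  have left: "fs_integral_exists (\<lambda>x. \<alpha> * f x + \<beta> * f2 x) g \<and>
      (\<forall>t\<in>{0..1}. fs_integral (\<lambda>x. \<alpha> * f x + \<beta> * f2 x) g t
        = \<alpha> * fs_integral f g t + \<beta> * fs_integral f2 g t)"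
    if "fs_integral_exists f2 g" for \<alpha> \<beta> f2
    using fs_integral_linear_combination[OF fg that dyadic_left_sum_linear(1)] by blast
  have right: "fs_integral_exists f (\<lambda>x. \<alpha> * g x + \<beta> * g2 x) \<and>
      (\<forall>t\<in>{0..1}. fs_integral f (\<lambda>x. \<alpha> * g x + \<beta> * g2 x) t
        = \<alpha> * fs_integral f g t + \<beta> * fs_integral f g2 t)"
    if "fs_integral_exists f g2" for \<alpha> \<beta> g2
    using fs_integral_linear_combination[OF fg that dyadic_left_sum_linear(2)] by blast
  have parts: "fs_int s t f g + fs_int s t g f = f t * g t - f s * g s"
    if "s \<in> {0..1}" "t \<in> {0..1}" for s t
    using fs_integral_by_parts[OF conj0 that(1)] fs_integral_by_parts[OF conj0 that(2)]
    by (simp add: fs_int_def)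
  have estimate: "ennreal \<bar>fs_int s t f g - f \<xi> * (g t - g s)\<bar>
      \<le> 8 * loeve_bound p' f N * loeve_bound q' g N"
    if "p' > 1" "q' > 1" "1 / p' + 1 / q' = 1" "f \<in> energy_space p'" "g \<in> energy_space q'"
      "0 \<le> s" "s \<le> \<xi>" "\<xi> \<le> t" "t \<le> 1" "t - s \<le> 1 / 2 ^ N" for p' q' s \<xi> t N
  proof -
    have "0 \<le> loeve p' f N * loeve q' g N"
      by (simp add: loeve_nonneg)
    then have "\<bar>fs_int s t f g - f \<xi> * (g t - g s)\<bar> \<le> 8 * loeve p' f N * loeve q' g N"
      using Young_Loeve_estimate[OF that] by linarith
    then have "ennreal \<bar>fs_int s t f g - f \<xi> * (g t - g s)\<bar>
        \<le> ennreal (8 * loeve p' f N * loeve q' g N)"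
      by (rule ennreal_leI)
    also have "\<dots> = 8 * loeve_bound p' f N * loeve_bound q' g N"
      using that by (simp add: loeve_bound_eq ennreal_mult loeve_nonneg)
    finally show ?thesis .
  qed
  show ?thesis
    using fg gf ex_conjugate_exponents[OF assms] left right parts estimate
    by (auto simp: fs_int_def)
qed

end
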